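(* Any finite connected simple planar graph admits a cycle $M$-basis.
   Context: Let $G=(V,E)$ be a finite connected undirected simple graph with a fixed orientation of its edges, and let $\partial : \mathbb{R}^E \to \mathbb{R}^V$ be the signed incidence matrix: the column of an edge has an entry $-1$ in the row of one endpoint and $+1$ in the row of the other endpoint (according to the orientation), and $0$ elsewhere. The lattice of integral flows of $G$ is $\mathcal{F}(G) = \mathbb{Z}^E \cap \ker(\partial)$, a free abelian group of rank $g = |E|-|V|+1$. Given a $\mathbb{Z}$-basis $\mathcal{B} = \{\mathbf{f}_1,\dots,\mathbf{f}_g\}$ of $\mathcal{F}(G)$, let $\iota$ be the $|E|\times g$ matrix with columns $\mathbf{f}_1,\dots,\mathbf{f}_g$; the associated dual Laplacian is $\mathcal{L}^* = \iota^T\iota$. An $n\times n$ matrix $L$ is a $Z$-matrix if $L_{ij}\le 0$ for all $i\ne j$. A $Z$-matrix $L$ is a (non-singular) $M$-matrix if all eigenvalues of $L$ have positive real part (equivalently, $L^{-1}$ exists and has all entries non-negative). $\mathcal{B}$ is an integral flow $M$-basis if $\mathcal{L}^*$ is an $M$-matrix. A cycle $M$-basis for $G$ is an integral flow $M$-basis each of whose elements encodes a directed (simple) cycle of $G$: all entries are in $\{0,1,-1\}$, the nonzero entries are exactly those at the edges of some simple cycle of $G$, and the signs are determined by comparing a cyclic orientation of that cycle with the fixed orientation of $G$ ($+1$ if they agree on the edge, $-1$ if they disagree). *)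

theory Defs
  imports "HOL-Analysis.Path_Connected" "Jordan_Normal_Form.Char_Poly"
begin

definition simple_graph :: "'v set \<Rightarrow> 'v set set \<Rightarrow> bool" where
  "simple_graph V E \<longleftrightarrow> finite V \<and> (\<forall>e\<in>E. e \<subseteq> V \<and> card e = 2)"

definition graph_connected :: "'v set \<Rightarrow> 'v set set \<Rightarrow> bool" where
  "graph_connected V E \<longleftrightarrow> V \<noteq> {} \<and> (\<forall>u\<in>V. \<forall>v\<in>V. (u, v) \<in> {(x, y). {x, y} \<in> E}\<^sup>*)"

text \<open>A drawing in the plane without crossings. The plane is the type \<^typ>\<open>complex\<close>; edges are
  drawn as arbitrary continuous arcs (injective on the closed unit interval).\<close>

definition plane_drawing ::
  "'v set \<Rightarrow> 'v set set \<Rightarrow> ('v \<Rightarrow> complex) \<Rightarrow> ('v set \<Rightarrow> real \<Rightarrow> complex) \<Rightarrow> bool" where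
  "plane_drawing V E p \<gamma> \<longleftrightarrow>
     inj_on p V \<and>
     (\<forall>e\<in>E. arc (\<gamma> e) \<and> {pathstart (\<gamma> e), pathfinish (\<gamma> e)} = p ` e
            \<and> path_image (\<gamma> e) \<inter> p ` V = p ` e) \<and>
     (\<forall>e\<in>E. \<forall>e'\<in>E. e \<noteq> e' \<longrightarrow> path_image (\<gamma> e) \<inter> path_image (\<gamma> e') = p ` (e \<inter> e'))"

definition planar_graph :: "'v set \<Rightarrow> 'v set set \<Rightarrow> bool" where
  "planar_graph V E \<longleftrightarrow> (\<exists>p \<gamma>. plane_drawing V E p \<gamma>)"

text \<open>An orientation sends each edge to the pair (tail, head).\<close>

definition orientation :: "'v set set \<Rightarrow> ('v set \<Rightarrow> 'v \<times> 'v) \<Rightarrow> bool" where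
  "orientation E ori \<longleftrightarrow> (\<forall>e\<in>E. {fst (ori e), snd (ori e)} = e)"

definition incidence :: "('v set \<Rightarrow> 'v \<times> 'v) \<Rightarrow> 'v \<Rightarrow> 'v set \<Rightarrow> real" where
  "incidence ori v e = (if v = fst (ori e) then -1 else if v = snd (ori e) then 1 else 0)"

text \<open>Vectors indexed by the edge set \<open>E\<close> are functions that vanish outside \<open>E\<close>.\<close>

definition flow_lattice ::
  "'v set \<Rightarrow> 'v set set \<Rightarrow> ('v set \<Rightarrow> 'v \<times> 'v) \<Rightarrow> ('v set \<Rightarrow> real) set" where
  "flow_lattice V E ori =
     {x. (\<forall>e. e \<notin> E \<longrightarrow> x e = 0) \<and> (\<forall>e\<in>E. x e \<in> \<int>) \<and>
         (\<forall>v\<in>V. (\<Sum>e\<in>E. incidence ori v e * x e) = 0)}"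

definition int_comb :: "(nat \<Rightarrow> int) \<Rightarrow> ('e \<Rightarrow> real) list \<Rightarrow> 'e \<Rightarrow> real" where
  "int_comb c fs = (\<lambda>e. \<Sum>i<length fs. of_int (c i) * (fs ! i) e)"

definition int_basis :: "('e \<Rightarrow> real) set \<Rightarrow> ('e \<Rightarrow> real) list \<Rightarrow> bool" where
  "int_basis F fs \<longleftrightarrow>
     set fs \<subseteq> F \<and>
     (\<forall>x\<in>F. \<exists>c. x = int_comb c fs) \<and>
     (\<forall>c. int_comb c fs = (\<lambda>e. 0) \<longrightarrow> (\<forall>i<length fs. c i = 0))"

text \<open>The matrix \<open>\<iota>\<^sup>T \<iota>\<close>, where \<open>\<iota>\<close> has rows indexed by \<open>E\<close> and columns \<open>fs ! 0, fs ! 1, \<dots>\<close>.\<close>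

definition dual_laplacian :: "'e set \<Rightarrow> ('e \<Rightarrow> real) list \<Rightarrow> real mat" where
  "dual_laplacian E fs = mat (length fs) (length fs) (\<lambda>(i, j). \<Sum>e\<in>E. (fs ! i) e * (fs ! j) e)"

definition Z_matrix :: "real mat \<Rightarrow> bool" where
  "Z_matrix L \<longleftrightarrow> square_mat L \<and>
     (\<forall>i<dim_row L. \<forall>j<dim_col L. i \<noteq> j \<longrightarrow> L $$ (i, j) \<le> 0)"

definition M_matrix :: "real mat \<Rightarrow> bool" where
  "M_matrix L \<longleftrightarrow> Z_matrix L \<and>
     (\<forall>k. eigenvalue (map_mat complex_of_real L) k \<longrightarrow> Re k > 0)"

definition flow_M_basis ::
  "'v set \<Rightarrow> 'v set set \<Rightarrow> ('v set \<Rightarrow> 'v \<times> 'v) \<Rightarrow> ('v set \<Rightarrow> real) list \<Rightarrow> bool" where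
  "flow_M_basis V E ori fs \<longleftrightarrow>
     int_basis (flow_lattice V E ori) fs \<and> M_matrix (dual_laplacian E fs)"

text \<open>A directed simple cycle is given by the cyclic sequence of its vertices; at least three of
  them, so that the cycle does not run back and forth along a single edge.\<close>

definition cycle_arcs :: "'v list \<Rightarrow> ('v \<times> 'v) set" where
  "cycle_arcs vs = {(vs ! i, vs ! (Suc i mod length vs)) | i. i < length vs}"

definition graph_cycle :: "'v set set \<Rightarrow> 'v list \<Rightarrow> bool" where
  "graph_cycle E vs \<longleftrightarrow> length vs \<ge> 3 \<and> distinct vs \<and> (\<forall>(u, v)\<in>cycle_arcs vs. {u, v} \<in> E)"

definition cycle_vector ::
  "'v set set \<Rightarrow> ('v set \<Rightarrow> 'v \<times> 'v) \<Rightarrow> 'v list \<Rightarrow> 'v set \<Rightarrow> real" where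
  "cycle_vector E ori vs =
     (\<lambda>e. if e \<in> E \<and> ori e \<in> cycle_arcs vs then 1
          else if e \<in> E \<and> prod.swap (ori e) \<in> cycle_arcs vs then -1
          else 0)"

definition cycle_M_basis ::
  "'v set \<Rightarrow> 'v set set \<Rightarrow> ('v set \<Rightarrow> 'v \<times> 'v) \<Rightarrow> ('v set \<Rightarrow> real) list \<Rightarrow> bool" where
  "cycle_M_basis V E ori fs \<longleftrightarrow>
     flow_M_basis V E ori fs \<and> (\<forall>f\<in>set fs. \<exists>vs. graph_cycle E vs \<and> f = cycle_vector E ori vs)"

end

theory Submission
  imports Defs "HOL-Analysis.Jordan_Curve" "HOL-Complex_Analysis.Winding_Numbers"
begin

text \<open>Call a cycle minimal if its inside is smallest among the insides of all cycles through some fixed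
  edge. A path of the graph through the inside of a cycle would split that inside (theta-curve lemma),
  so two minimal cycles that have a common edge and whose insides meet coincide. Orient the minimal
  cycles with winding number \<open>1\<close> inside: two of them that traverse a common edge in the same direction
  have intersecting insides. Hence distinct minimal cycles traverse common edges in opposite
  directions, which makes the off-diagonal entries of the dual Laplacian nonpositive. A basis of such
  cycles is obtained by successively removing an edge \<open>e\<close> of a cycle that borders the unbounded face,
  and adding a minimal cycle through \<open>e\<close>: flows are reduced to flows avoiding \<open>e\<close> by means of it. The
  dual Laplacian is a Gram matrix of linearly independent vectors, so its eigenvalues are positive.\<close>

section \<open>Vertex lists and their arcs\<close>

text \<open>Recursive, unlike the indexed \<open>cycle_arcs\<close>, so that curves and sums along a
  path can be built by induction on the list.\<close>

fun path_arcs :: "'v list \<Rightarrow> ('v \<times> 'v) set" where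
  "path_arcs (x # y # xs) = insert (x, y) (path_arcs (y # xs))"
| "path_arcs _ = {}"

text \<open>Arcs keep the direction of traversal, which winding numbers and signs depend on;
  drawings depend only on the underlying edges. The vertices of an arc set are its
  \<open>Field\<close>.\<close>

definition edges_of :: "('v \<times> 'v) set \<Rightarrow> 'v set set" where
  "edges_of A = (\<lambda>(u, v). {u, v}) ` A"

lemma edges_of_simps [simp]:
  "edges_of {} = {}"
  "edges_of (insert (u, v) A) = insert {u, v} (edges_of A)"
  "edges_of (A \<union> B) = edges_of A \<union> edges_of B"
  "edges_of (A\<inverse>) = edges_of A"
  by (force simp: edges_of_def insert_commute)+

lemma edges_ofI: "(u, v) \<in> A \<Longrightarrow> {u, v} \<in> edges_of A"
  by (force simp: edges_of_def)

lemma edges_of_Field: "{u, v} \<in> edges_of A \<Longrightarrow> u \<in> Field A \<and> v \<in> Field A"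
  by (force simp: edges_of_def doubleton_eq_iff Field_def)

lemma finite_path_arcs [simp]: "finite (path_arcs xs)"
  by (induction xs rule: path_arcs.induct) auto

lemma path_arcs_append:
  "path_arcs (xs @ a # ys) = path_arcs (xs @ [a]) \<union> path_arcs (a # ys)"
  by (induction xs rule: path_arcs.induct) auto

lemma path_arcs_snoc: "path_arcs (xs @ [a, b]) = insert (a, b) (path_arcs (xs @ [a]))"
  using path_arcs_append[of xs a "[b]"] by auto

lemma path_arcs_rev: "path_arcs (rev xs) = (path_arcs xs)\<inverse>"
  by (induction xs rule: path_arcs.induct) (auto simp: path_arcs_snoc)

lemma Field_path_arcs: "2 \<le> length xs \<Longrightarrow> Field (path_arcs xs) = set xs"
proof (induction xs rule: path_arcs.induct)
  case (1 x y xs)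
  then show ?case by (cases xs) auto
qed auto

lemma path_arcs_conv_nth: "path_arcs xs = {(xs ! i, xs ! Suc i) |i. Suc i < length xs}"
proof (induction xs rule: path_arcs.induct)
  case (1 x y xs)
  have "{((x # y # xs) ! i, (x # y # xs) ! Suc i) |i. Suc i < length (x # y # xs)} =
    insert (x, y) {((y # xs) ! i, (y # xs) ! Suc i) |i. Suc i < length (y # xs)}"
    (is "?L = ?R")
  proof
    show "?L \<subseteq> ?R"
    proof
      fix a assume "a \<in> ?L"
      then obtain i where i: "a = ((x # y # xs) ! i, (x # y # xs) ! Suc i)"
        "Suc i < length (x # y # xs)" by blast
      then show "a \<in> ?R" by (cases i) auto
    qed
    show "?R \<subseteq> ?L"
      by (force intro: exI[of _ "Suc _"] exI[of _ 0])
  qed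
  with 1 show ?case by simp
qed auto

text \<open>Of two consecutive positions, at most one is an end of the list once there is something
  in between. This keeps the closing arc of a cycle apart from the arcs of its path.\<close>

lemma path_arcs_interior:
  "(u, v) \<in> path_arcs (a # xs @ [b]) \<Longrightarrow> xs \<noteq> [] \<Longrightarrow> u \<in> set xs \<or> v \<in> set xs"
proof (induction xs arbitrary: a)
  case (Cons x xs)
  then show ?case by (cases xs) auto
qed simp

lemma path_arcs_asym:
  assumes "distinct xs" "(u, v) \<in> path_arcs xs"
  shows "(v, u) \<notin> path_arcs xs"
proof
  assume "(v, u) \<in> path_arcs xs"
  then obtain j where j: "v = xs ! j" "u = xs ! Suc j" "Suc j < length xs"
    unfolding path_arcs_conv_nth by blast
  obtain i where i: "u = xs ! i" "v = xs ! Suc i" "Suc i < length xs"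
    using assms(2) unfolding path_arcs_conv_nth by blast
  have "i = Suc j" "Suc i = j"
    using i j assms(1) nth_eq_iff_index_eq[of xs] by (metis Suc_lessD)+
  then show False by simp
qed

text \<open>A common edge has both ends in {a, b} because the interiors are disjoint; by
  \<open>path_arcs_interior\<close> both paths are then the single edge from a to b, which the last
  assumption excludes.\<close>

lemma path_arcs_edge_disjoint:
  assumes "set xs \<inter> set ys = {}" "distinct (a # xs @ [b])" "distinct (a # ys @ [b])"
    and "xs \<noteq> [] \<or> ys \<noteq> []"
  shows "edges_of (path_arcs (a # xs @ [b])) \<inter> edges_of (path_arcs (a # ys @ [b])) = {}"
proof (rule ccontr)
  assume "\<not> ?thesis"
  then obtain u v where uv: "(u, v) \<in> path_arcs (a # xs @ [b])"
    "{u, v} \<in> edges_of (path_arcs (a # ys @ [b]))"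
    by (force simp: edges_of_def)
  have F: "Field (path_arcs (a # ys @ [b])) = set (a # ys @ [b])" for ys
    by (rule Field_path_arcs) simp
  have 1: "u \<in> {a, b}" "v \<in> {a, b}"
    using edges_of_Field[OF uv(2)] edges_of_Field[OF edges_ofI[OF uv(1)]] assms(1)
    unfolding F by auto
  then have "xs = []" using path_arcs_interior[OF uv(1)] assms(2) by auto
  moreover have "ys = []"
  proof (rule ccontr)
    assume "ys \<noteq> []"
    moreover obtain x y where "(x, y) \<in> path_arcs (a # ys @ [b])" "{u, v} = {x, y}"
      using uv(2) by (auto simp: edges_of_def)
    ultimately have "u \<in> set ys \<or> v \<in> set ys"
      using path_arcs_interior[of x y a ys b] by (auto simp: doubleton_eq_iff)
    then show False using 1 assms(3) by auto
  qed
  ultimately show False using assms(4) by simp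
qed

section \<open>Simple cycles as closed paths: rotation, reversal, cutting open\<close>

lemma cycle_arcs_eq_path_arcs:
  assumes "vs \<noteq> []"
  shows "cycle_arcs vs = path_arcs (vs @ [hd vs])"
proof -
  have *: "vs ! (Suc i mod length vs) = (vs @ [hd vs]) ! Suc i" if "i < length vs" for i
  proof (cases "Suc i = length vs")
    case True
    then show ?thesis using assms by (simp add: nth_append hd_conv_nth)
  next
    case False
    then show ?thesis using that by (simp add: nth_append)
  qed
  have "cycle_arcs vs = (\<lambda>i. (vs ! i, vs ! (Suc i mod length vs))) ` {..<length vs}"
    by (auto simp: cycle_arcs_def)
  also have "\<dots> = (\<lambda>i. ((vs @ [hd vs]) ! i, (vs @ [hd vs]) ! Suc i)) ` {..<length vs}"
    by (rule image_cong) (simp_all add: * nth_append)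
  also have "\<dots> = path_arcs (vs @ [hd vs])"
    unfolding path_arcs_conv_nth by auto
  finally show ?thesis .
qed

lemma cycle_arcs_Cons: "cycle_arcs (a # xs) = path_arcs (a # xs @ [a])"
  by (simp add: cycle_arcs_eq_path_arcs)

lemma cycle_arcs_snoc: "cycle_arcs (a # xs @ [b]) = insert (b, a) (path_arcs (a # xs @ [b]))"
  using path_arcs_snoc[of "a # xs" b a] by (simp add: cycle_arcs_Cons)

lemma cycle_arcs_rotate: "cycle_arcs (xs @ ys) = cycle_arcs (ys @ xs)"
proof (cases xs; cases ys)
  fix a xs' b ys' assume *: "xs = a # xs'" "ys = b # ys'"
  have "path_arcs (a # xs' @ b # ys' @ [a]) = path_arcs (b # ys' @ a # xs' @ [b])"
    using path_arcs_append[of "a # xs'" b "ys' @ [a]"] path_arcs_append[of "b # ys'" a "xs' @ [b]"]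
    by auto
  then show ?thesis using * by (simp add: cycle_arcs_Cons)
qed auto

lemma cycle_arcs_rev: "cycle_arcs (rev vs) = (cycle_arcs vs)\<inverse>"
proof (cases vs)
  case (Cons a ws)
  have "cycle_arcs (rev vs) = cycle_arcs (a # rev ws)"
    using Cons cycle_arcs_rotate[of "rev ws" "[a]"] by simp
  also have "\<dots> = path_arcs (rev (a # ws @ [a]))"
    by (simp add: cycle_arcs_Cons)
  also have "\<dots> = (cycle_arcs vs)\<inverse>"
    unfolding path_arcs_rev using Cons by (simp add: cycle_arcs_Cons)
  finally show ?thesis .
qed (simp add: cycle_arcs_def)

lemma finite_cycle_arcs [simp]: "finite (cycle_arcs vs)"
  by (simp add: cycle_arcs_def)

lemma Field_cycle_arcs: "vs \<noteq> [] \<Longrightarrow> Field (cycle_arcs vs) = set vs"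
  by (cases vs) (auto simp: cycle_arcs_eq_path_arcs Field_path_arcs)

lemma graph_cycle_iff:
  "graph_cycle F vs \<longleftrightarrow> 3 \<le> length vs \<and> distinct vs \<and> edges_of (cycle_arcs vs) \<subseteq> F"
  by (auto simp: graph_cycle_def edges_of_def)

lemma graph_cycle_mono: "graph_cycle F vs \<Longrightarrow> F \<subseteq> F' \<Longrightarrow> graph_cycle F' vs"
  by (auto simp: graph_cycle_iff)

lemma graph_cycle_rotate: "graph_cycle F (xs @ ys) \<longleftrightarrow> graph_cycle F (ys @ xs)"
  by (auto simp: graph_cycle_iff cycle_arcs_rotate[of xs ys] Int_commute)

lemma graph_cycle_rev: "graph_cycle F (rev vs) \<longleftrightarrow> graph_cycle F vs"
  by (auto simp: graph_cycle_iff cycle_arcs_rev)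

lemma Field_graph_cycle: "graph_cycle F vs \<Longrightarrow> Field (cycle_arcs vs) = set vs"
  by (rule Field_cycle_arcs) (auto simp: graph_cycle_iff)

lemma graph_cycleE:
  assumes "graph_cycle F vs"
  obtains a ws b where "vs = a # ws @ [b]" "ws \<noteq> []"
proof -
  have "3 \<le> length vs" using assms by (simp add: graph_cycle_iff)
  then obtain a b c xs where "vs = a # b # c # xs"
    by (auto simp: numeral_3_eq_3 Suc_le_length_iff)
  then have "vs = a # butlast (b # c # xs) @ [last (b # c # xs)]" by simp
  then show ?thesis using that by (metis butlast.simps(2) list.distinct(1))
qed

text \<open>Here the length of at least three matters: since \<open>ws\<close> is nonempty, the path
  from a to b does not join its two ends directly, so the closing arc has no reverse on the
  cycle.\<close>

lemma cycle_arcs_asym: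
  assumes "graph_cycle F vs" "(u, v) \<in> cycle_arcs vs"
  shows "(v, u) \<notin> cycle_arcs vs"
proof -
  obtain a ws b where vs: "vs = a # ws @ [b]" "ws \<noteq> []" using assms(1) by (rule graph_cycleE)
  have d: "distinct vs" using assms(1) by (simp add: graph_cycle_iff)
  have "(a, b) \<notin> path_arcs vs" "(b, a) \<notin> path_arcs vs"
    using path_arcs_interior[of _ _ a ws b] vs d by auto
  then show ?thesis
    using assms(2) path_arcs_asym[OF d] d vs cycle_arcs_snoc[of a ws b] by auto
qed

text \<open>Rotating the list makes the given arc the closing one, and what remains is a path from v
  back to u.\<close>

lemma graph_cycle_cut_arc:
  assumes "graph_cycle F vs" "(u, v) \<in> cycle_arcs vs"
  obtains ws where "graph_cycle F ws" "cycle_arcs ws = cycle_arcs vs" "hd ws = v" "last ws = u"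
    "cycle_arcs vs = insert (u, v) (path_arcs ws)"
proof -
  obtain i where i: "i < length vs" "u = vs ! i" "v = vs ! (Suc i mod length vs)"
    using assms(2) by (auto simp: cycle_arcs_def)
  define ws where "ws = drop (Suc i) vs @ take (Suc i) vs"
  have vs: "vs = take (Suc i) vs @ drop (Suc i) vs" by simp
  have gc: "graph_cycle F ws" "cycle_arcs ws = cycle_arcs vs"
    using assms(1) vs graph_cycle_rotate cycle_arcs_rotate unfolding ws_def by metis+
  have l: "last ws = u"
    using i by (auto simp: ws_def take_Suc_conv_app_nth)
  have h: "hd ws = v"
  proof (cases "Suc i < length vs")
    case True
    then show ?thesis using i by (simp add: ws_def hd_append hd_drop_conv_nth)
  next
    \<comment> \<open>If u is the last entry, v is the first one and the rotation is
      trivial.\<close>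
    case False
    then have "Suc i = length vs" using i by simp
    then show ?thesis using i hd_conv_nth[of vs] by (cases vs) (auto simp: ws_def)
  qed
  obtain a ys b where "ws = a # ys @ [b]" using gc(1) by (rule graph_cycleE)
  then have "cycle_arcs vs = insert (u, v) (path_arcs ws)"
    using cycle_arcs_snoc[of a ys b] gc l h by auto
  then show ?thesis using that gc l h by blast
qed

lemma graph_cycle_split:
  assumes "graph_cycle F vs" "a \<in> set vs" "b \<in> set vs" "a \<noteq> b"
  obtains xs ys where "graph_cycle F (a # xs @ b # ys)"
    "cycle_arcs (a # xs @ b # ys) = cycle_arcs vs"
    "set (a # xs @ b # ys) = set vs"
proof -
  obtain us ws where vs: "vs = us @ a # ws" using assms(2) by (auto dest: split_list)
  then have "b \<in> set (ws @ us)" using assms by auto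
  then obtain xs ys where *: "ws @ us = xs @ b # ys" by (meson split_list)
  have "graph_cycle F ((a # ws) @ us)" "cycle_arcs ((a # ws) @ us) = cycle_arcs vs"
    using assms(1) vs graph_cycle_rotate cycle_arcs_rotate by metis+
  moreover have "set ((a # ws) @ us) = set vs" using vs by auto
  ultimately show ?thesis using that * by simp
qed

text \<open>The way back is reversed so that both paths run from a to b, the form that the
  theta-curve lemma expects.\<close>

lemma cycle_arcs_two_paths:
  "cycle_arcs (a # xs @ b # ys) = path_arcs (a # xs @ [b]) \<union> (path_arcs (a # rev ys @ [b]))\<inverse>"
  using path_arcs_append[of "a # xs" b "ys @ [a]"] path_arcs_rev[of "a # rev ys @ [b]"]
  by (simp add: cycle_arcs_Cons)

section \<open>Curves along vertex lists of a plane graph\<close>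

locale plane_graph =
  fixes V :: "'v set" and E :: "'v set set"
    and p :: "'v \<Rightarrow> complex" and \<gamma> :: "'v set \<Rightarrow> real \<Rightarrow> complex"
  assumes simple: "simple_graph V E" and drawing: "plane_drawing V E p \<gamma>"
begin

lemma finite_V: "finite V"
  using simple by (simp add: simple_graph_def)

lemma edge_subset: "e \<in> E \<Longrightarrow> e \<subseteq> V"
  using simple by (simp add: simple_graph_def)

lemma finite_E: "finite E"
  using finite_V edge_subset by (metis Pow_iff finite_Pow_iff finite_subset subsetI)

lemma edge_doubleton: "e \<in> E \<Longrightarrow> \<exists>u v. e = {u, v} \<and> u \<noteq> v"
  using simple by (auto simp: simple_graph_def card_2_iff)

lemma edge_ends: "{u, v} \<in> E \<Longrightarrow> u \<in> V \<and> v \<in> V \<and> u \<noteq> v"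
  using simple edge_subset by (fastforce simp: simple_graph_def)

lemma Field_subset_V:
  assumes "edges_of A \<subseteq> E"
  shows "Field A \<subseteq> V"
proof
  fix x assume "x \<in> Field A"
  then obtain y where "(x, y) \<in> A \<or> (y, x) \<in> A" by (auto simp: Field_def)
  then have "{x, y} \<in> edges_of A" using edges_ofI by (metis insert_commute)
  then show "x \<in> V" using edge_ends[of x y] assms by auto
qed

lemma arc_edge: "e \<in> E \<Longrightarrow> arc (\<gamma> e)"
  using drawing by (simp add: plane_drawing_def)

lemma inj_p: "u \<in> V \<Longrightarrow> v \<in> V \<Longrightarrow> p u = p v \<longleftrightarrow> u = v"
  using drawing by (auto simp: plane_drawing_def inj_on_def)

lemma edge_Int_vertices: "e \<in> E \<Longrightarrow> path_image (\<gamma> e) \<inter> p ` V = p ` e"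
  using drawing by (simp add: plane_drawing_def)

lemma edge_Int_edge:
  "e \<in> E \<Longrightarrow> e' \<in> E \<Longrightarrow> e \<noteq> e' \<Longrightarrow> path_image (\<gamma> e) \<inter> path_image (\<gamma> e') = p ` (e \<inter> e')"
  using drawing by (simp add: plane_drawing_def)

text \<open>The drawing of an undirected edge may run either way; this version always runs from
  \<open>p u\<close> to \<open>p v\<close>.\<close>

definition arc_curve :: "'v \<Rightarrow> 'v \<Rightarrow> real \<Rightarrow> complex" where
  "arc_curve u v = (if pathstart (\<gamma> {u, v}) = p u then \<gamma> {u, v} else reversepath (\<gamma> {u, v}))"

lemma arc_curve:
  assumes "{u, v} \<in> E"
  shows "arc (arc_curve u v)" "pathstart (arc_curve u v) = p u" "pathfinish (arc_curve u v) = p v"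
    "path_image (arc_curve u v) = path_image (\<gamma> {u, v})"
proof -
  have *: "{pathstart (\<gamma> {u, v}), pathfinish (\<gamma> {u, v})} = {p u, p v}" and a: "arc (\<gamma> {u, v})"
    using assms drawing by (auto simp: plane_drawing_def)
  have "p u \<noteq> p v" using assms edge_ends inj_p by metis
  with * show "pathstart (arc_curve u v) = p u" "pathfinish (arc_curve u v) = p v"
    by (auto simp: arc_curve_def doubleton_eq_iff)
  show "arc (arc_curve u v)" "path_image (arc_curve u v) = path_image (\<gamma> {u, v})"
    using a by (auto simp: arc_curve_def arc_reversepath)
qed

lemma arc_curve_swap:
  assumes "{u, v} \<in> E"
  shows "arc_curve v u = reversepath (arc_curve u v)"
proof -
  have *: "{pathstart (\<gamma> {u, v}), pathfinish (\<gamma> {u, v})} = {p u, p v}"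
    using assms drawing by (auto simp: plane_drawing_def)
  have "p u \<noteq> p v" using assms edge_ends inj_p by metis
  with * show ?thesis by (auto simp: arc_curve_def insert_commute doubleton_eq_iff)
qed

definition draw :: "('v \<times> 'v) set \<Rightarrow> complex set" where
  "draw A = (\<Union>e\<in>edges_of A. path_image (\<gamma> e))"

lemma draw_simps [simp]:
  "draw {} = {}"
  "draw (insert (u, v) A) = path_image (\<gamma> {u, v}) \<union> draw A"
  "draw (A \<union> B) = draw A \<union> draw B"
  "draw (A\<inverse>) = draw A"
  by (simp_all add: draw_def)

lemma draw_vertex_iff:
  assumes "edges_of A \<subseteq> E" "v \<in> V"
  shows "p v \<in> draw A \<longleftrightarrow> v \<in> Field A"
proof
  assume "p v \<in> draw A"
  then obtain a b where ab: "(a, b) \<in> A" "p v \<in> path_image (\<gamma> {a, b})"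
    by (auto simp: draw_def edges_of_def)
  then have "{a, b} \<in> E" using edges_ofI[OF ab(1)] assms(1) by auto
  then have *: "p v \<in> p ` {a, b}" "a \<in> V" "b \<in> V"
    using ab(2) edge_Int_vertices[of "{a, b}"] assms(2) edge_ends[of a b] by auto
  then have "v = a \<or> v = b" using inj_p assms(2) by auto
  then show "v \<in> Field A" using ab(1) by (auto intro: FieldI1 FieldI2)
next
  assume "v \<in> Field A"
  then obtain e where e: "e \<in> edges_of A" "v \<in> e"
    by (auto simp: Field_def edges_of_def)
  then have "p v \<in> path_image (\<gamma> e)" using edge_Int_vertices[of e] assms by blast
  then show "p v \<in> draw A" using e by (auto simp: draw_def)
qed

text \<open>A common point lies on two different edges, and in a plane drawing these meet only in
  the images of common endpoints.\<close>

lemma draw_Int_subset: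
  assumes "edges_of A \<subseteq> E" "edges_of B \<subseteq> E" "edges_of A \<inter> edges_of B = {}"
  shows "draw A \<inter> draw B \<subseteq> p ` (Field A \<inter> Field B)"
proof
  fix z assume "z \<in> draw A \<inter> draw B"
  then obtain e f where *: "e \<in> edges_of A" "f \<in> edges_of B"
    "z \<in> path_image (\<gamma> e)" "z \<in> path_image (\<gamma> f)"
    by (auto simp: draw_def)
  then have "z \<in> p ` (e \<inter> f)" using edge_Int_edge[of e f] assms by blast
  moreover have "e \<subseteq> Field A" "f \<subseteq> Field B"
    using * by (auto simp: edges_of_def Field_def)
  ultimately show "z \<in> p ` (Field A \<inter> Field B)" by blast
qed

lemma draw_Int_eq:
  assumes "edges_of A \<subseteq> E" "edges_of B \<subseteq> E" "edges_of A \<inter> edges_of B = {}"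
  shows "draw A \<inter> draw B = p ` (Field A \<inter> Field B)"
  using draw_Int_subset[OF assms] draw_vertex_iff[OF assms(1)] draw_vertex_iff[OF assms(2)]
    Field_subset_V[OF assms(1)] by blast

lemma closed_draw: "finite A \<Longrightarrow> edges_of A \<subseteq> E \<Longrightarrow> closed (draw A)"
  unfolding draw_def using arc_edge
  by (intro closed_UN) (auto simp: edges_of_def intro!: closed_arc_image)

text \<open>A sum over single arcs rather than the winding number of one closed curve: it does not
  depend on a starting vertex, and an arc can be taken out of it. For an arc set that is not closed
  the value need not be an integer.\<close>

definition winding :: "('v \<times> 'v) set \<Rightarrow> complex \<Rightarrow> complex" where
  "winding A z = (\<Sum>(u, v)\<in>A. winding_number (arc_curve u v) z)"

lemma winding_insert:
  "finite A \<Longrightarrow> (u, v) \<notin> A \<Longrightarrow>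
    winding (insert (u, v) A) z = winding_number (arc_curve u v) z + winding A z"
  by (simp add: winding_def)

lemma winding_converse:
  assumes "edges_of A \<subseteq> E" "z \<notin> draw A"
  shows "winding (A\<inverse>) z = - winding A z"
proof -
  have "winding (A\<inverse>) z = (\<Sum>(v, u)\<in>A\<inverse>. winding_number (arc_curve v u) z)"
    by (simp add: winding_def)
  also have "\<dots> = (\<Sum>(u, v)\<in>A. winding_number (arc_curve v u) z)"
    by (rule sum.reindex_bij_witness[of _ prod.swap prod.swap]) auto
  also have "\<dots> = (\<Sum>(u, v)\<in>A. - winding_number (arc_curve u v) z)"
  proof (rule sum.cong)
    fix x assume x: "x \<in> A"
    obtain u v where uv: "x = (u, v)" by fastforce
    have "{u, v} \<in> edges_of A" using x uv edges_ofI[of u v A] by simp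
    then have e: "{u, v} \<in> E" "{u, v} \<in> edges_of A" using assms(1) by auto
    then have "z \<notin> path_image (arc_curve u v)"
      using assms(2) arc_curve(4) by (auto simp: draw_def)
    then have "winding_number (arc_curve v u) z = - winding_number (arc_curve u v) z"
      using arc_curve_swap[OF e(1)] winding_number_reversepath arc_imp_path[OF arc_curve(1)[OF e(1)]]
      by simp
    then show "(case x of (u, v) \<Rightarrow> winding_number (arc_curve v u) z) =
        (case x of (u, v) \<Rightarrow> - winding_number (arc_curve u v) z)"
      using uv by simp
  qed simp
  also have "\<dots> = - winding A z"
    by (simp add: winding_def case_prod_unfold sum_negf)
  finally show ?thesis .
qed

lemma continuous_winding:
  assumes "finite A" "edges_of A \<subseteq> E" "z \<notin> draw A"
  shows "continuous (at z) (winding A)"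
proof -
  have "continuous (at z) (\<lambda>z. winding_number (arc_curve u v) z)" if "(u, v) \<in> A" for u v
    using assms that edges_ofI[OF that] arc_curve(1)[of u v] arc_curve(4)[of u v] arc_imp_path
    by (intro continuous_at_winding_number) (auto simp: draw_def)
  then show ?thesis
    unfolding winding_def case_prod_unfold by (intro continuous_sum) auto
qed

text \<open>Arcs are joined one by one. The new vertex x is not on the rest of the path, so the new
  arc meets the curve only in \<open>p y\<close>; the join is again injective and winding numbers
  add up.\<close>

lemma path_arcs_curve:
  assumes "distinct xs" "2 \<le> length xs" "edges_of (path_arcs xs) \<subseteq> E"
  shows "\<exists>c. arc c \<and> pathstart c = p (hd xs) \<and> pathfinish c = p (last xs) \<and>
    path_image c = draw (path_arcs xs) \<and>
    (\<forall>z. z \<notin> draw (path_arcs xs) \<longrightarrow> winding_number c z = winding (path_arcs xs) z)"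
  using assms
proof (induction xs rule: path_arcs.induct)
  case (1 x y xs)
  have e: "{x, y} \<in> E" using 1 by simp
  show ?case
  proof (cases xs)
    case Nil
    then show ?thesis
      using arc_curve[OF e] by (intro exI[of _ "arc_curve x y"]) (simp add: winding_def)
  next
    case (Cons w ws)
    obtain c where c: "arc c" "pathstart c = p y" "pathfinish c = p (last (y # xs))"
      "path_image c = draw (path_arcs (y # xs))"
      "\<And>z. z \<notin> draw (path_arcs (y # xs)) \<Longrightarrow> winding_number c z = winding (path_arcs (y # xs)) z"
      using 1 Cons by auto
    have F: "Field (path_arcs (y # xs)) = set (y # xs)"
      using Cons by (intro Field_path_arcs) auto
    have x: "x \<notin> set (y # xs)" using 1 by auto
    have "{x, y} \<notin> edges_of (path_arcs (y # xs))"
      using edges_of_Field F x by metis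
    then have "path_image (\<gamma> {x, y}) \<inter> draw (path_arcs (y # xs)) \<subseteq> {p y}"
      using draw_Int_subset[of "{(x, y)}" "path_arcs (y # xs)"] F x e 1 by auto
    then have "arc (arc_curve x y +++ c)"
      using c arc_curve[OF e] by (intro arc_join) auto
    moreover have "winding_number (arc_curve x y +++ c) z = winding (path_arcs (x # y # xs)) z"
      if "z \<notin> draw (path_arcs (x # y # xs))" for z
    proof -
      have "(x, y) \<notin> path_arcs (y # xs)" using F x by (metis FieldI1)
      then show ?thesis
        using that c arc_curve[OF e] by (simp add: winding_number_join arc_imp_path winding_insert)
    qed
    ultimately show ?thesis
      using c arc_curve[OF e] Cons
      by (intro exI[of _ "arc_curve x y +++ c"]) (auto simp: path_image_join)
  qed
qed auto

text \<open>The closing arc is not an edge of the open path, so it meets the path only in its two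
  ends and completes a Jordan curve.\<close>

lemma cycle_curve:
  assumes "graph_cycle E vs"
  shows "\<exists>c. simple_path c \<and> pathfinish c = pathstart c \<and> path_image c = draw (cycle_arcs vs) \<and>
    (\<forall>z. z \<notin> draw (cycle_arcs vs) \<longrightarrow> winding_number c z = winding (cycle_arcs vs) z)"
proof -
  obtain a ws b where vs: "vs = a # ws @ [b]" "ws \<noteq> []" using assms by (rule graph_cycleE)
  have d: "distinct vs" and E: "edges_of (cycle_arcs vs) \<subseteq> E"
    using assms by (auto simp: graph_cycle_iff)
  have arcs: "cycle_arcs vs = insert (b, a) (path_arcs vs)"
    using vs cycle_arcs_snoc by metis
  obtain c where c: "arc c" "pathstart c = p a" "pathfinish c = p b"
      "path_image c = draw (path_arcs vs)"
      "\<And>z. z \<notin> draw (path_arcs vs) \<Longrightarrow> winding_number c z = winding (path_arcs vs) z"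
    using path_arcs_curve[OF d] E arcs vs by auto
  have e: "{b, a} \<in> E" using E arcs by auto
  have F: "Field (path_arcs vs) = set vs" using vs by (intro Field_path_arcs) auto
  have ne: "(a, b) \<notin> path_arcs vs" "(b, a) \<notin> path_arcs vs"
    using path_arcs_interior[of _ _ a ws b] vs d by auto
  then have "{b, a} \<notin> edges_of (path_arcs vs)"
    by (auto simp: edges_of_def doubleton_eq_iff)
  then have "path_image (\<gamma> {b, a}) \<inter> draw (path_arcs vs) \<subseteq> {p a, p b}"
    using draw_Int_subset[of "{(b, a)}" "path_arcs vs"] F e E arcs by auto
  then have "simple_path (c +++ arc_curve b a)"
    using c arc_curve[OF e] by (intro simple_path_join_loop) auto
  moreover have "winding_number (c +++ arc_curve b a) z = winding (cycle_arcs vs) z"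
    if "z \<notin> draw (cycle_arcs vs)" for z
    using that c arc_curve[OF e] ne arcs
    by (simp add: winding_number_join arc_imp_path winding_insert)
  ultimately show ?thesis
    using c arc_curve[OF e] arcs
    by (intro exI[of _ "c +++ arc_curve b a"]) (auto simp: path_image_join)
qed

lemma cycle_inside:
  assumes "graph_cycle E vs"
  shows "open (inside (draw (cycle_arcs vs)))"
    "connected (inside (draw (cycle_arcs vs)))"
    "frontier (inside (draw (cycle_arcs vs))) = draw (cycle_arcs vs)"
proof -
  obtain c where "simple_path c" "pathfinish c = pathstart c" "path_image c = draw (cycle_arcs vs)"
    using cycle_curve[OF assms] by blast
  then show "open (inside (draw (cycle_arcs vs)))"
    "connected (inside (draw (cycle_arcs vs)))"
    "frontier (inside (draw (cycle_arcs vs))) = draw (cycle_arcs vs)"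
    using Jordan_inside_outside[of c] by simp_all
qed

section \<open>Orientation\<close>

text \<open>Counterclockwise traversal, expressed by the winding number.\<close>

definition positive_cycle :: "'v list \<Rightarrow> bool" where
  "positive_cycle vs \<longleftrightarrow> (\<forall>z\<in>inside (draw (cycle_arcs vs)). winding (cycle_arcs vs) z = 1)"

lemma winding_outside:
  assumes "graph_cycle E vs" "z \<in> outside (draw (cycle_arcs vs))"
  shows "winding (cycle_arcs vs) z = 0"
proof -
  obtain c where c: "simple_path c" "pathfinish c = pathstart c" "path_image c = draw (cycle_arcs vs)"
    "\<forall>z. z \<notin> draw (cycle_arcs vs) \<longrightarrow> winding_number c z = winding (cycle_arcs vs) z"
    using cycle_curve[OF assms(1)] by blast
  have "z \<notin> draw (cycle_arcs vs)" using assms(2) outside_no_overlap by blast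
  then show ?thesis
    using c assms(2) winding_number_zero_in_outside[of c z] simple_path_imp_path by auto
qed

text \<open>A simple closed curve winds around all points inside it once, with one common sign, and
  reversal flips that sign.\<close>

lemma positive_cycle_cases:
  assumes "graph_cycle E vs"
  shows "positive_cycle vs \<or> positive_cycle (rev vs)"
proof -
  obtain c where c: "simple_path c" "path_image c = draw (cycle_arcs vs)"
    "\<forall>z. z \<notin> draw (cycle_arcs vs) \<longrightarrow> winding_number c z = winding (cycle_arcs vs) z"
    using cycle_curve[OF assms(1)] by blast
  have E: "edges_of (cycle_arcs vs) \<subseteq> E" using assms by (simp add: graph_cycle_iff)
  have *: "z \<notin> draw (cycle_arcs vs)" if "z \<in> inside (draw (cycle_arcs vs))" for z
    using that inside_no_overlap by blast
  from c(1) show ?thesis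
  proof (cases rule: simple_closed_path_winding_number_inside)
    case 1
    then have "positive_cycle vs" using c * by (simp add: positive_cycle_def)
    then show ?thesis ..
  next
    case 2
    then have "positive_cycle (rev vs)"
      using c * E by (simp add: positive_cycle_def cycle_arcs_rev winding_converse)
    then show ?thesis ..
  qed
qed

lemma edge_interior_point:
  assumes "e \<in> E"
  obtains z where "z \<in> path_image (\<gamma> e)" "z \<notin> p ` V"
proof -
  have "infinite (path_image (\<gamma> e))"
    using arc_edge[OF assms] finite_imageD[of "\<gamma> e" "{0..1}"] infinite_Icc[of "0::real" 1]
    by (auto simp: arc_def path_image_def)
  then have "\<not> path_image (\<gamma> e) \<subseteq> p ` V"
    using finite_V finite_subset by blast
  then show ?thesis using that by blast
qed

text \<open>Different edges meet only in vertices. A point of an edge that is no vertex thus detects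
  whether a drawing contains this edge.\<close>

lemma interior_point_in_draw_iff:
  assumes "e \<in> E" "z \<in> path_image (\<gamma> e)" "z \<notin> p ` V" "edges_of A \<subseteq> E"
  shows "z \<in> draw A \<longleftrightarrow> e \<in> edges_of A"
proof -
  have "z \<notin> path_image (\<gamma> f)" if "f \<in> E" "f \<noteq> e" for f
    using that assms edge_Int_edge[of e f] edge_subset[of e] by blast
  then show ?thesis using assms by (auto simp: draw_def)
qed

text \<open>Were the two insides disjoint, the winding number of the difference of the two cycles, which
  is continuous at a midpoint of the common arc, would be near \<open>1\<close> and near \<open>-1\<close> there.\<close>

lemma insides_meet_if_common_arc:
  assumes C: "graph_cycle E C" "positive_cycle C" and D: "graph_cycle E D" "positive_cycle D"
    and uv: "(u, v) \<in> cycle_arcs C" "(u, v) \<in> cycle_arcs D"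
  shows "inside (draw (cycle_arcs C)) \<inter> inside (draw (cycle_arcs D)) \<noteq> {}"
proof
  assume disj: "inside (draw (cycle_arcs C)) \<inter> inside (draw (cycle_arcs D)) = {}"
  let ?A = "cycle_arcs C - {(u, v)}" and ?B = "cycle_arcs D - {(u, v)}"
  have E: "edges_of (cycle_arcs C) \<subseteq> E" "edges_of (cycle_arcs D) \<subseteq> E"
    using C D by (simp_all add: graph_cycle_iff)
  have A: "cycle_arcs C = insert (u, v) ?A" and B: "cycle_arcs D = insert (u, v) ?B"
    using uv by auto
  have AE: "edges_of ?A \<subseteq> E" and BE: "edges_of ?B \<subseteq> E"
    using E by (auto simp: edges_of_def)
  have e: "{u, v} \<in> E" using edges_ofI[OF uv(1)] E by auto
  have "{u, v} \<notin> edges_of ?A" "{u, v} \<notin> edges_of ?B"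
    using cycle_arcs_asym[OF C(1) uv(1)] cycle_arcs_asym[OF D(1) uv(2)]
    by (auto simp: edges_of_def doubleton_eq_iff)
  moreover obtain m where m: "m \<in> path_image (\<gamma> {u, v})" "m \<notin> p ` V"
    using edge_interior_point[OF e] by blast
  ultimately have nm: "m \<notin> draw ?A \<union> draw ?B"
    using interior_point_in_draw_iff[OF e m] AE BE by blast
  \<comment> \<open>The common arc, across which both winding numbers jump, is left out of both
    terms, so \<open>h\<close> is continuous at \<open>m\<close>. Its contributions to the two full
    cycles cancel in the difference.\<close>
  define h where "h z = winding ?A z - winding ?B z" for z
  have h: "h z = winding (cycle_arcs C) z - winding (cycle_arcs D) z" for z
    using winding_insert[of ?A u v z] winding_insert[of ?B u v z] uv
    by (simp add: h_def insert_absorb)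
  have "continuous (at m) h"
    unfolding h_def using nm AE BE by (intro continuous_diff continuous_winding) auto
  moreover have "(1::real) > 0" by simp
  ultimately obtain d where d: "d > 0" "\<And>z. dist z m < d \<Longrightarrow> dist (h z) (h m) < 1"
    unfolding continuous_at_eps_delta by blast
  have "open (- (draw ?A \<union> draw ?B))"
    using closed_draw[OF _ AE] closed_draw[OF _ BE]
    by (intro open_Compl closed_Un) auto
  then obtain d' where d': "d' > 0" "\<And>z. dist z m < d' \<Longrightarrow> z \<notin> draw ?A \<union> draw ?B"
    using nm by (metis ComplD ComplI open_dist)
  \<comment> \<open>\<open>m\<close> is on the frontier of both insides, so each inside has points
    arbitrarily close to it.\<close>
  have near: "\<exists>z\<in>inside (draw (cycle_arcs vs)). dist z m < min d d'"
    if "graph_cycle E vs" "(u, v) \<in> cycle_arcs vs" for vs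
  proof -
    have "m \<in> draw (cycle_arcs vs)"
      using edges_ofI[OF that(2)] m by (auto simp: draw_def)
    then have "m \<in> closure (inside (draw (cycle_arcs vs)))"
      using cycle_inside(3)[OF that(1)] unfolding frontier_def by blast
    moreover have "min d d' > 0" using d(1) d'(1) by simp
    ultimately show ?thesis
      unfolding closure_approachable by blast
  qed
  obtain z where z: "z \<in> inside (draw (cycle_arcs C))" "dist z m < d" "dist z m < d'"
    using near[OF C(1) uv(1)] by auto
  obtain w where w: "w \<in> inside (draw (cycle_arcs D))" "dist w m < d" "dist w m < d'"
    using near[OF D(1) uv(2)] by auto
  have dC: "draw (cycle_arcs C) = path_image (\<gamma> {u, v}) \<union> draw ?A"
    and dD: "draw (cycle_arcs D) = path_image (\<gamma> {u, v}) \<union> draw ?B"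
    by (rule arg_cong[OF A, of draw, unfolded draw_simps(2)],
        rule arg_cong[OF B, of draw, unfolded draw_simps(2)])
  \<comment> \<open>Within distance \<open>d'\<close> of \<open>m\<close> both drawings consist of
    points of the common arc only. As \<open>z\<close> is off the drawing of C, it is off that of D
    as well.\<close>
  have "z \<notin> draw (cycle_arcs D)"
    using z(1) d'(2)[OF z(3)] inside_no_overlap[of "draw (cycle_arcs C)"] dC dD by blast
  then have "z \<in> outside (draw (cycle_arcs D))"
    using z(1) disj inside_Un_outside by blast
  then have 1: "h z = 1"
    using z(1) C(2) winding_outside[OF D(1)] by (simp add: h positive_cycle_def)
  have "w \<notin> draw (cycle_arcs C)"
    using w(1) d'(2)[OF w(3)] inside_no_overlap[of "draw (cycle_arcs D)"] dC dD by blast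
  then have "w \<in> outside (draw (cycle_arcs C))"
    using w(1) disj inside_Un_outside by blast
  then have 2: "h w = -1"
    using w(1) D(2) winding_outside[OF C(1)] by (simp add: h positive_cycle_def)
  have "dist (h z) (h w) < 2"
    using d(2)[OF z(2)] d(2)[OF w(2)] dist_triangle2[of "h z" "h w" "h m"] by simp
  then show False by (simp add: 1 2 dist_norm)
qed

section \<open>Minimal cycles\<close>

abbreviation region :: "'v list \<Rightarrow> complex set" where
  "region vs \<equiv> inside (draw (cycle_arcs vs))"

text \<open>The two halves of the cycle and the chord are three arcs from \<open>p a\<close> to
  \<open>p b\<close> that meet only there. By the theta-curve lemma the chord splits the inside into
  the insides of the two new cycles and the open chord; both inclusions are strict because a chord
  point in the inside belongs to neither part.\<close>

lemma chord_splits_region: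
  assumes F: "F \<subseteq> E" and C: "graph_cycle F (a # xs @ b # ys)"
    and P: "distinct (a # zs @ [b])" "edges_of (path_arcs (a # zs @ [b])) \<subseteq> F"
    and disj: "set zs \<inter> set (a # xs @ b # ys) = {}"
    and meet: "draw (path_arcs (a # zs @ [b])) \<inter> region (a # xs @ b # ys) \<noteq> {}"
  shows "graph_cycle F (a # xs @ b # rev zs)" "region (a # xs @ b # rev zs) \<subset> region (a # xs @ b # ys)"
    and "graph_cycle F (a # zs @ b # ys)" "region (a # zs @ b # ys) \<subset> region (a # xs @ b # ys)"
proof -
  let ?X = "path_arcs (a # xs @ [b])" and ?Y = "path_arcs (a # rev ys @ [b])"
    and ?Z = "path_arcs (a # zs @ [b])"
  have arcs: "cycle_arcs (a # xs @ b # ys) = ?X \<union> ?Y\<inverse>"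
    "cycle_arcs (a # xs @ b # rev zs) = ?X \<union> ?Z\<inverse>"
    "cycle_arcs (a # zs @ b # ys) = ?Z \<union> ?Y\<inverse>"
    by (simp_all add: cycle_arcs_two_paths)
  have d: "distinct (a # xs @ b # ys)" and len: "xs \<noteq> [] \<or> ys \<noteq> []"
    and XYF: "edges_of ?X \<subseteq> F" "edges_of ?Y \<subseteq> F"
    using C arcs by (auto simp: graph_cycle_iff)
  \<comment> \<open>If the chord and one half of the cycle were both the single edge {a, b}, the
    chord would lie on the cycle and could not meet its inside.\<close>
  have noedge: "zs = [] \<Longrightarrow> xs \<noteq> [] \<and> ys \<noteq> []"
  proof (rule ccontr)
    assume "zs = []" "\<not> (xs \<noteq> [] \<and> ys \<noteq> [])"
    then have "draw ?Z \<subseteq> draw (?X \<union> ?Y\<inverse>)" by (auto simp: insert_commute)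
    then show False
      using meet inside_no_overlap[of "draw (?X \<union> ?Y\<inverse>)"] unfolding arcs(1) by blast
  qed
  have gr: "graph_cycle F (a # xs @ b # rev zs)" "graph_cycle F (a # zs @ b # ys)"
    using d P disj noedge XYF unfolding graph_cycle_iff arcs
    by (auto simp: Suc_le_eq numeral_3_eq_3)
  have dX: "distinct (a # xs @ [b])" and dY: "distinct (a # rev ys @ [b])"
    using d by auto
  have ed: "edges_of ?X \<inter> edges_of ?Y = {}" "edges_of ?X \<inter> edges_of ?Z = {}"
    "edges_of ?Y \<inter> edges_of ?Z = {}"
    using d disj len noedge by (intro path_arcs_edge_disjoint dX dY P; auto)+
  have Fi: "Field (path_arcs (a # us @ [b])) = set (a # us @ [b])" for us
    by (rule Field_path_arcs) simp
  have E: "edges_of ?X \<subseteq> E" "edges_of ?Y \<subseteq> E" "edges_of ?Z \<subseteq> E"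
    using XYF P F by auto
  have Int: "draw ?X \<inter> draw ?Y = {p a, p b}" "draw ?X \<inter> draw ?Z = {p a, p b}"
    "draw ?Y \<inter> draw ?Z = {p a, p b}"
  proof -
    have "set (a # xs @ [b]) \<inter> set (a # rev ys @ [b]) = {a, b}"
      "set (a # xs @ [b]) \<inter> set (a # zs @ [b]) = {a, b}"
      "set (a # rev ys @ [b]) \<inter> set (a # zs @ [b]) = {a, b}"
      using d disj by auto
    then show "draw ?X \<inter> draw ?Y = {p a, p b}" "draw ?X \<inter> draw ?Z = {p a, p b}"
      "draw ?Y \<inter> draw ?Z = {p a, p b}"
      using draw_Int_eq[OF E(1) E(2) ed(1)] draw_Int_eq[OF E(1) E(3) ed(2)]
        draw_Int_eq[OF E(2) E(3) ed(3)]
      unfolding Fi by simp_all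
  qed
  obtain c1 where c1: "arc c1" "pathstart c1 = p a" "pathfinish c1 = p b" "path_image c1 = draw ?X"
    using path_arcs_curve[OF dX _ E(1)] by auto
  obtain c2 where c2: "arc c2" "pathstart c2 = p a" "pathfinish c2 = p b" "path_image c2 = draw ?Y"
    using path_arcs_curve[OF dY _ E(2)] by auto
  obtain c where c: "arc c" "pathstart c = p a" "pathfinish c = p b" "path_image c = draw ?Z"
    using path_arcs_curve[OF P(1) _ E(3)] by auto
  have "p a \<noteq> p b" using arc_distinct_ends[OF c(1)] c by simp
  then have eq: "inside (draw ?X \<union> draw ?Z) \<union> inside (draw ?Y \<union> draw ?Z) \<union> (draw ?Z - {p a, p b}) =
      inside (draw ?X \<union> draw ?Y)"
    using split_inside_simple_closed_curve[of c1 "p a" "p b" c2 c] c1 c2 c Int meet arcs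
      arc_imp_simple_path by (metis draw_simps(3,4))
  obtain w where w: "w \<in> draw ?Z" "w \<in> inside (draw ?X \<union> draw ?Y)"
    using meet arcs by auto
  have "w \<notin> inside (draw ?X \<union> draw ?Z)" "w \<notin> inside (draw ?Y \<union> draw ?Z)"
    using w(1) inside_no_overlap by blast+
  with eq w have "inside (draw ?X \<union> draw ?Z) \<subset> inside (draw ?X \<union> draw ?Y)"
    "inside (draw ?Z \<union> draw ?Y) \<subset> inside (draw ?X \<union> draw ?Y)"
    by (auto simp: Un_commute)
  then show "graph_cycle F (a # xs @ b # rev zs)" "region (a # xs @ b # rev zs) \<subset> region (a # xs @ b # ys)"
    "graph_cycle F (a # zs @ b # ys)" "region (a # zs @ b # ys) \<subset> region (a # xs @ b # ys)"
    using gr unfolding arcs by simp_all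
qed

text \<open>Minimality with respect to a single edge suffices: when a chord splits the inside, this
  edge lies on one of the two smaller cycles. It also lets a minimal cycle be found through any
  prescribed edge that lies on a cycle.\<close>

definition minimal_cycle :: "'v set set \<Rightarrow> 'v list \<Rightarrow> bool" where
  "minimal_cycle F C \<longleftrightarrow> graph_cycle F C \<and> (\<exists>e\<in>edges_of (cycle_arcs C).
     \<forall>D. graph_cycle F D \<and> e \<in> edges_of (cycle_arcs D) \<longrightarrow> \<not> region D \<subset> region C)"

text \<open>If D entered the inside of C, a segment of D between two vertices of C would be a chord,
  and one of the two smaller cycles it cuts off would contain the edge for which C is
  minimal.\<close>

lemma minimal_cycle_region_empty:
  assumes F: "F \<subseteq> E" and C: "minimal_cycle F C" and D: "graph_cycle F D"
    and shared: "edges_of (cycle_arcs C) \<inter> edges_of (cycle_arcs D) \<noteq> {}"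
  shows "draw (cycle_arcs D) \<inter> region C = {}"
proof (rule ccontr)
  assume "\<not> ?thesis"
  then obtain w where w: "w \<in> draw (cycle_arcs D)" "w \<in> region C" by blast
  have gC: "graph_cycle F C" using C by (simp add: minimal_cycle_def)
  obtain s t where st: "(s, t) \<in> cycle_arcs D" "{s, t} \<in> edges_of (cycle_arcs C)"
  proof -
    obtain e where e: "e \<in> edges_of (cycle_arcs C)" "e \<in> edges_of (cycle_arcs D)"
      using shared by blast
    then obtain x where x: "x \<in> cycle_arcs D" "e = {fst x, snd x}"
      by (auto simp: edges_of_def case_prod_unfold)
    show ?thesis using e x that[of "fst x" "snd x"] by simp
  qed
  \<comment> \<open>Cut at the shared edge, D becomes a path with both ends on C. From the arc
    through \<open>w\<close>, following this path in either direction therefore leads to a vertex of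
    C.\<close>
  obtain D' where D': "graph_cycle F D'" "cycle_arcs D' = cycle_arcs D" "hd D' = t" "last D' = s"
    "cycle_arcs D = insert (s, t) (path_arcs D')"
    using graph_cycle_cut_arc[OF D st(1)] by metis
  have stC: "s \<in> set C" "t \<in> set C"
    using edges_of_Field[OF st(2)] Field_graph_cycle[OF gC] by simp_all
  have "path_image (\<gamma> {s, t}) \<subseteq> draw (cycle_arcs C)" using st by (auto simp: draw_def)
  then have "w \<in> draw (path_arcs D')"
    using w D'(5) inside_no_overlap by fastforce
  then obtain u v where uv: "(u, v) \<in> path_arcs D'" "w \<in> path_image (\<gamma> {u, v})"
    by (auto simp: draw_def edges_of_def)
  obtain i where i: "u = D' ! i" "v = D' ! Suc i" "Suc i < length D'"
    using uv(1) by (auto simp: path_arcs_conv_nth)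
  have D'_split: "D' = take i D' @ u # v # drop (Suc (Suc i)) D'"
    using i by (metis Suc_lessD id_take_nth_drop Cons_nth_drop_Suc)
  \<comment> \<open>The chord ends in the last vertex \<open>a\<close> of C up to \<open>u\<close>
    and in the first vertex \<open>b\<close> of C from \<open>v\<close> on; the vertices in between
    avoid C.\<close>
  have "hd D' \<in> set (take i D' @ [u])"
    by (subst D'_split) (cases "take i D'", auto)
  then have "\<exists>x\<in>set (take i D' @ [u]). x \<in> set C" using D'(3) stC by blast
  then obtain A1 a zs1 where A1: "take i D' @ [u] = A1 @ a # zs1" "a \<in> set C" "set zs1 \<inter> set C = {}"
    by (rule split_list_last_propE) blast
  have "last D' \<in> set (v # drop (Suc (Suc i)) D')"
    by (subst D'_split) (metis last_appendR last_ConsR last_in_set list.distinct(1))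
  then have "\<exists>x\<in>set (v # drop (Suc (Suc i)) D'). x \<in> set C" using D'(4) stC by blast
  then obtain zs2 b B1 where B1: "v # drop (Suc (Suc i)) D' = zs2 @ b # B1" "b \<in> set C" "set zs2 \<inter> set C = {}"
    by (rule split_list_first_propE) blast
  define zs where "zs = zs1 @ zs2"
  have D'_eq: "D' = A1 @ a # zs @ b # B1"
    using D'_split A1(1) B1(1) unfolding zs_def
    by (metis append.assoc append_Cons append_Nil)
  have dD: "distinct D'" using D'(1) by (simp add: graph_cycle_iff)
  then have dP: "distinct (a # zs @ [b])" unfolding D'_eq by auto
  have "path_arcs D' = path_arcs (A1 @ [a]) \<union> (path_arcs (a # zs @ [b]) \<union> path_arcs (b # B1))"
    unfolding D'_eq using path_arcs_append[of A1 a "zs @ b # B1"] path_arcs_append[of "a # zs" b B1]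
    by simp
  then have PF: "edges_of (path_arcs (a # zs @ [b])) \<subseteq> F"
    using D'(1,2,5) by (auto simp: graph_cycle_iff)
  \<comment> \<open>The arc through \<open>w\<close> survives in the segment, which therefore meets
    the inside of C.\<close>
  have uvP: "(u, v) \<in> path_arcs (a # zs @ [b])"
  proof -
    have "\<exists>us vs. a # zs @ [b] = us @ u # v # vs"
    proof -
      have "last (a # zs1) = u" using A1(1) by (metis last_appendR last_snoc list.distinct(1))
      then have l: "a # zs1 = butlast (a # zs1) @ [u]" by (metis append_butlast_last_id list.distinct(1))
      have "hd (zs2 @ [b]) = v" using B1(1) by (cases zs2) auto
      then have r: "zs2 @ [b] = v # tl (zs2 @ [b])" by (metis list.collapse Nil_is_append_conv list.distinct(1))
      have "a # zs @ [b] = (a # zs1) @ (zs2 @ [b])" by (simp add: zs_def)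
      also have "\<dots> = butlast (a # zs1) @ u # v # tl (zs2 @ [b])" by (subst l, subst r) simp
      finally show ?thesis by blast
    qed
    then obtain us vs where *: "a # zs @ [b] = us @ u # v # vs" by blast
    show ?thesis using path_arcs_append[of us u "v # vs"] unfolding * by simp
  qed
  then have wP: "w \<in> draw (path_arcs (a # zs @ [b]))"
    using uv(2) edges_ofI by (fastforce simp: draw_def)
  have "a \<noteq> b" using dP by simp
  then obtain xs ys where C': "graph_cycle F (a # xs @ b # ys)"
    "cycle_arcs (a # xs @ b # ys) = cycle_arcs C" "set (a # xs @ b # ys) = set C"
    using graph_cycle_split[OF gC A1(2) B1(2)] by metis
  have "set zs \<inter> set (a # xs @ b # ys) = {}" using A1(3) B1(3) C'(3) by (auto simp: zs_def)
  then have split: "graph_cycle F (a # xs @ b # rev zs)" "region (a # xs @ b # rev zs) \<subset> region C"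
    "graph_cycle F (a # zs @ b # ys)" "region (a # zs @ b # ys) \<subset> region C"
    using chord_splits_region[OF F C'(1) dP PF, unfolded C'(2)] wP w(2) by blast+
  have "edges_of (cycle_arcs C) \<subseteq>
      edges_of (cycle_arcs (a # xs @ b # rev zs)) \<union> edges_of (cycle_arcs (a # zs @ b # ys))"
    unfolding C'(2)[symmetric] cycle_arcs_two_paths by simp blast
  moreover obtain e where e: "e \<in> edges_of (cycle_arcs C)"
    "\<And>B. graph_cycle F B \<Longrightarrow> e \<in> edges_of (cycle_arcs B) \<Longrightarrow> \<not> region B \<subset> region C"
    using C unfolding minimal_cycle_def by blast
  ultimately consider "e \<in> edges_of (cycle_arcs (a # xs @ b # rev zs))" |
      "e \<in> edges_of (cycle_arcs (a # zs @ b # ys))"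
    by blast
  then show False using e(2)[OF split(1)] e(2)[OF split(3)] split(2,4) by cases blast+
qed

text \<open>Neither drawing enters the other inside. A connected inside that avoids the other
  drawing and meets the other inside is contained in it; by symmetry the insides agree, and so do
  their frontiers.\<close>

lemma minimal_cycles_eq:
  assumes F: "F \<subseteq> E" and C: "minimal_cycle F C" and D: "minimal_cycle F D"
    and shared: "edges_of (cycle_arcs C) \<inter> edges_of (cycle_arcs D) \<noteq> {}"
    and meet: "region C \<inter> region D \<noteq> {}"
  shows "draw (cycle_arcs C) = draw (cycle_arcs D)"
proof -
  have sub: "region A \<subseteq> region B"
    if A: "graph_cycle E A" "draw (cycle_arcs B) \<inter> region A = {}" "region A \<inter> region B \<noteq> {}"
    for A B
  proof
    fix y assume y: "y \<in> region A"
    obtain z where z: "z \<in> region A" "z \<in> region B" using A(3) by blast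
    have "connected_component (- draw (cycle_arcs B)) z y"
      unfolding connected_component_def
      using cycle_inside(2)[OF A(1)] A(2) y z by blast
    then show "y \<in> region B" using z(2) by (rule inside_same_component)
  qed
  have g: "graph_cycle F C" "graph_cycle F D" using C D by (simp_all add: minimal_cycle_def)
  then have gE: "graph_cycle E C" "graph_cycle E D" using graph_cycle_mono F by blast+
  have "draw (cycle_arcs D) \<inter> region C = {}"
    by (rule minimal_cycle_region_empty[OF F C g(2) shared])
  moreover have "draw (cycle_arcs C) \<inter> region D = {}"
    using shared by (intro minimal_cycle_region_empty[OF F D g(1)]) (simp add: Int_commute)
  ultimately have "region C = region D"
    using sub[OF gE(1), of D] sub[OF gE(2), of C] meet by blast
  then show ?thesis using cycle_inside(3) gE by metis
qed

end

section \<open>Flows\<close>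

text \<open>The boundary of a path telescopes: inner vertices are entered once and left
  once.\<close>

lemma sum_path_arcs:
  fixes v :: 'v
  assumes "distinct xs" "2 \<le> length xs"
  shows "(\<Sum>(a, b)\<in>path_arcs xs. of_bool (v = b) - of_bool (v = a) :: real) =
    of_bool (v = last xs) - of_bool (v = hd xs)"
  using assms
proof (induction xs rule: path_arcs.induct)
  case (1 x y xs)
  show ?case
  proof (cases "xs = []")
    case False
    then have "(x, y) \<notin> path_arcs (y # xs)"
      using Field_path_arcs[of "y # xs"] 1(2) FieldI1[of x y "path_arcs (y # xs)"]
      by (cases xs) auto
    then show ?thesis using 1 False by (cases xs) auto
  qed auto
qed auto

lemma sum_cycle_arcs:
  assumes "graph_cycle F vs"
  shows "(\<Sum>(a, b)\<in>cycle_arcs vs. of_bool (v = b) - of_bool (v = a) :: real) = 0"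
proof -
  obtain a ws b where vs: "vs = a # ws @ [b]" "ws \<noteq> []" using assms by (rule graph_cycleE)
  have d: "distinct vs" using assms by (simp add: graph_cycle_iff)
  have "(b, a) \<notin> path_arcs vs"
    using path_arcs_interior[of b a a ws b] vs d by auto
  then show ?thesis
    using sum_path_arcs[OF d, of v] cycle_arcs_snoc[of a ws b] vs by simp
qed

text \<open>The case distinction becomes a difference of indicators because a cycle never contains
  an arc together with its reverse. As a sum over arcs it can be exchanged with sums over
  edges.\<close>

lemma cycle_vector_eq_sum:
  assumes "graph_cycle F C" "e \<in> E" "orientation E ori"
  shows "cycle_vector E ori C e =
    (\<Sum>(a, b)\<in>cycle_arcs C. of_bool (ori e = (a, b)) - of_bool (ori e = (b, a)))"
proof -
  obtain u v where uv: "ori e = (u, v)" by fastforce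
  have *: "(case x of (a, b) \<Rightarrow> of_bool (ori e = (a, b)) - of_bool (ori e = (b, a))) =
      (if x = (u, v) then 1 else (0::real)) - (if x = (v, u) then 1 else 0)" for x
  proof -
    obtain a b where x: "x = (a, b)" by fastforce
    have "(u, v) = (a, b) \<longleftrightarrow> x = (u, v)" "(u, v) = (b, a) \<longleftrightarrow> x = (v, u)"
      unfolding x by blast+
    then show ?thesis unfolding uv by (simp add: x of_bool_def)
  qed
  have "(\<Sum>(a, b)\<in>cycle_arcs C. of_bool (ori e = (a, b)) - of_bool (ori e = (b, a)) :: real) =
    (\<Sum>x\<in>cycle_arcs C. if x = (u, v) then 1 else 0) - (\<Sum>x\<in>cycle_arcs C. if x = (v, u) then 1 else 0)"
    unfolding sum_subtractf[symmetric] by (rule sum.cong[OF refl *])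
  also have "\<dots> = of_bool ((u, v) \<in> cycle_arcs C) - of_bool ((v, u) \<in> cycle_arcs C)"
    by (simp add: of_bool_def)
  also have "\<dots> = cycle_vector E ori C e"
    using cycle_arcs_asym[OF assms(1), of u v] assms(2) uv by (auto simp: cycle_vector_def)
  finally show ?thesis by simp
qed

lemma cycle_vector_eq_0:
  assumes "orientation E ori" "e \<notin> edges_of (cycle_arcs C)"
  shows "cycle_vector E ori C e = 0"
proof (cases "e \<in> E")
  case True
  obtain u v where uv: "ori e = (u, v)" by fastforce
  have "e = {u, v}" using assms(1) True uv by (auto simp: orientation_def)
  then have "(u, v) \<notin> cycle_arcs C" "(v, u) \<notin> cycle_arcs C"
    using assms(2) edges_ofI insert_commute by metis+
  then show ?thesis using uv by (simp add: cycle_vector_def)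
qed (simp add: cycle_vector_def)

lemma cycle_vector_edge:
  assumes "orientation E ori" "e \<in> E" "e \<in> edges_of (cycle_arcs C)"
  shows "cycle_vector E ori C e \<in> {1, -1}"
proof -
  obtain u v where uv: "ori e = (u, v)" by fastforce
  have "e = {u, v}" using assms uv by (auto simp: orientation_def)
  then have "(u, v) \<in> cycle_arcs C \<or> (v, u) \<in> cycle_arcs C"
    using assms(3) by (auto simp: edges_of_def doubleton_eq_iff)
  then show ?thesis using uv assms(2) by (auto simp: cycle_vector_def)
qed

text \<open>Cycles without a common arc traverse every common edge in opposite directions.\<close>

lemma cycle_vector_mult_nonpos:
  assumes "cycle_arcs C \<inter> cycle_arcs D = {}"
  shows "cycle_vector E ori C e * cycle_vector E ori D e \<le> 0"
  using assms by (auto simp: cycle_vector_def)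

lemma cycle_vector_Ints: "cycle_vector E ori C e \<in> \<int>"
  by (auto simp: cycle_vector_def)

lemma int_comb_Cons: "int_comb c (f # fs) = (\<lambda>e. of_int (c 0) * f e + int_comb (c \<circ> Suc) fs e)"
  by (simp add: int_comb_def sum.lessThan_Suc_shift del: sum.lessThan_Suc)

context plane_graph
begin

text \<open>After exchanging the sums, an arc (a, b) contributes only through the edge {a, b}.
  Whichever way this edge is oriented, the contribution is +1 at b and -1 at a, and around a cycle
  these cancel.\<close>

lemma cycle_vector_flow:
  assumes F: "F \<subseteq> E" and C: "graph_cycle F C" and ori: "orientation E ori"
  shows "cycle_vector E ori C \<in> flow_lattice V F ori"
proof -
  let ?A = "cycle_arcs C"
  have AF: "edges_of ?A \<subseteq> F" using C by (simp add: graph_cycle_iff)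
  have fF: "finite F" using F finite_E finite_subset by blast
  have "(\<Sum>e\<in>F. incidence ori v e * cycle_vector E ori C e) = 0" for v
  proof -
    have "(\<Sum>e\<in>F. incidence ori v e * cycle_vector E ori C e) =
      (\<Sum>e\<in>F. \<Sum>x\<in>?A. incidence ori v e * (of_bool (ori e = x) - of_bool (ori e = prod.swap x)))"
      using F by (intro sum.cong refl)
        (auto simp: cycle_vector_eq_sum[OF C _ ori] sum_distrib_left case_prod_unfold
          prod.swap_def intro!: sum.cong)
    also have "\<dots> =
      (\<Sum>x\<in>?A. \<Sum>e\<in>F. incidence ori v e * (of_bool (ori e = x) - of_bool (ori e = prod.swap x)))"
      by (rule sum.swap)
    also have "\<dots> = (\<Sum>(a, b)\<in>?A. of_bool (v = b) - of_bool (v = a))"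
    proof (rule sum.cong)
      fix x assume x: "x \<in> ?A"
      obtain a b where ab: "x = (a, b)" by fastforce
      have e: "{a, b} \<in> F" using x ab AF edges_ofI[of a b ?A] by auto
      then have "a \<noteq> b" using edge_ends F by blast
      have ends: "e = {a, b}" if "e \<in> F" "ori e = (a, b) \<or> ori e = (b, a)" for e
        using that ori F by (force simp: orientation_def)
      have "fst (ori {a, b}) = a \<and> snd (ori {a, b}) = b \<or> fst (ori {a, b}) = b \<and> snd (ori {a, b}) = a"
        using ori e F unfolding orientation_def by (metis doubleton_eq_iff subsetD)
      then have oab: "ori {a, b} = (a, b) \<or> ori {a, b} = (b, a)" by (metis prod.collapse)
      have "(\<Sum>e\<in>F. incidence ori v e * (of_bool (ori e = x) - of_bool (ori e = prod.swap x))) =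
        (\<Sum>e\<in>{{a, b}}. incidence ori v e * (of_bool (ori e = x) - of_bool (ori e = prod.swap x)))"
      proof (rule sum.mono_neutral_right[OF fF])
        show "\<forall>e\<in>F - {{a, b}}. incidence ori v e * (of_bool (ori e = x) - of_bool (ori e = prod.swap x)) = 0"
        proof
          fix e assume "e \<in> F - {{a, b}}"
          then have "ori e \<noteq> (a, b)" "ori e \<noteq> (b, a)" using ends by blast+
          then show "incidence ori v e * (of_bool (ori e = x) - of_bool (ori e = prod.swap x)) = 0"
            by (simp add: ab)
        qed
      qed (use e in simp)
      also have "\<dots> = of_bool (v = b) - of_bool (v = a)"
        using oab ab \<open>a \<noteq> b\<close> by (auto simp: incidence_def)
      finally show "(\<Sum>e\<in>F. incidence ori v e * (of_bool (ori e = x) - of_bool (ori e = prod.swap x))) =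
        (case x of (a, b) \<Rightarrow> of_bool (v = b) - of_bool (v = a))"
        using ab by simp
    qed simp
    also have "\<dots> = 0" by (rule sum_cycle_arcs[OF C])
    finally show ?thesis .
  qed
  moreover have "cycle_vector E ori C e = 0" if "e \<notin> F" for e
    using cycle_vector_eq_0[OF ori] that AF by blast
  ultimately show ?thesis
    by (simp add: flow_lattice_def cycle_vector_Ints)
qed

text \<open>In the support of a nonzero flow no vertex has degree one, so a longest path in the
  support closes up to a cycle.\<close>

lemma acyclic_flow_eq_0:
  assumes F: "F \<subseteq> E" and ac: "\<nexists>C. graph_cycle F C" and ori: "orientation E ori"
    and x: "x \<in> flow_lattice V F ori"
  shows "x = (\<lambda>e. 0)"
proof (rule ccontr)
  assume "x \<noteq> (\<lambda>e. 0)"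
  define S where "S = {e \<in> F. x e \<noteq> 0}"
  have fF: "finite F" using F finite_E finite_subset by blast
  have SE: "S \<subseteq> E" using F by (auto simp: S_def)
  \<comment> \<open>Were \<open>e\<close> the only support edge at \<open>v\<close>, conservation at
    \<open>v\<close> would reduce to x e = 0 up to sign.\<close>
  have deg: "\<exists>e'\<in>S. e' \<noteq> e \<and> v \<in> e'" if e: "e \<in> S" "v \<in> e" for e v
  proof (rule ccontr)
    assume no: "\<not> ?thesis"
    have inc0: "incidence ori v e' = 0" if "e' \<in> E" "v \<notin> e'" for e'
      using that ori by (auto simp: incidence_def orientation_def)
    have "(\<Sum>e'\<in>F. incidence ori v e' * x e') = (\<Sum>e'\<in>{e}. incidence ori v e' * x e')"
      using e no inc0 F by (intro sum.mono_neutral_right fF) (auto simp: S_def)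
    moreover have "v \<in> V" using e SE edge_subset by blast
    ultimately have "incidence ori v e * x e = 0"
      using x by (simp add: flow_lattice_def)
    moreover have "incidence ori v e \<noteq> 0"
    proof -
      have "{fst (ori e), snd (ori e)} = e" using e SE ori by (auto simp: orientation_def)
      then show ?thesis using e(2) by (auto simp: incidence_def)
    qed
    ultimately show False using e(1) by (simp add: S_def)
  qed
  define P where "P xs \<longleftrightarrow> distinct xs \<and> 2 \<le> length xs \<and> edges_of (path_arcs xs) \<subseteq> S"
    for xs :: "'v list"
  have bound: "length xs < Suc (card V)" if "P xs" for xs
  proof -
    have "set xs \<subseteq> V"
      using that SE Field_subset_V[of "path_arcs xs"] Field_path_arcs[of xs] by (auto simp: P_def)
    then have "card (set xs) \<le> card V" by (rule card_mono[OF finite_V])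
    then show ?thesis using that distinct_card[of xs] by (simp add: P_def)
  qed
  obtain e0 where "e0 \<in> S"
    using \<open>x \<noteq> (\<lambda>e. 0)\<close> x by (auto simp: S_def flow_lattice_def fun_eq_iff)
  then obtain s t where "{s, t} \<in> S" "s \<noteq> t" using SE edge_doubleton by blast
  then have "P [s, t]" by (simp add: P_def)
  then have "\<exists>xs. P xs \<and> (\<forall>ys. P ys \<longrightarrow> length ys \<le> length xs)"
    by (rule ex_has_greatest_nat) (use bound in auto)
  then obtain xs where xs: "P xs" "\<And>ys. P ys \<Longrightarrow> length ys \<le> length xs" by auto
  obtain a b ws where ab: "xs = a # b # ws"
    using xs(1) by (auto simp: P_def numeral_2_eq_2 Suc_le_length_iff)
  then have "{a, b} \<in> S" using xs(1) by (simp add: P_def)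
  then obtain e' where e': "e' \<in> S" "e' \<noteq> {a, b}" "a \<in> e'" using deg[of "{a, b}" a] by auto
  then obtain y where y: "e' = {a, y}" "y \<noteq> a" using edge_doubleton[of e'] SE by auto
  \<comment> \<open>Otherwise \<open>y\<close> would extend the longest path. Moreover
    \<open>y\<close> differs from \<open>b\<close>, since the edge to it is not {a, b}, so the cycle
    closed by this edge has at least three vertices.\<close>
  have "y \<in> set xs"
  proof (rule ccontr)
    assume "y \<notin> set xs"
    then have "P (y # xs)" using xs(1) e' y ab by (auto simp: P_def insert_commute)
    then show False using xs(2) by fastforce
  qed
  then have "y \<in> set ws" using y e' ab by auto
  then obtain w1 w2 where w: "ws = w1 @ y # w2" by (meson split_list)
  have "xs = (a # b # w1) @ y # w2" by (simp add: ab w)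
  then have "path_arcs (a # b # w1 @ [y]) \<subseteq> path_arcs xs"
    using path_arcs_append[of "a # b # w1" y w2] by auto
  then have "edges_of (path_arcs (a # b # w1 @ [y])) \<subseteq> S"
    using xs(1) by (auto simp: P_def edges_of_def)
  then have "graph_cycle F (a # b # w1 @ [y])"
    using xs(1) e' y cycle_arcs_snoc[of a "b # w1" y] ab w
    by (auto simp: graph_cycle_iff P_def S_def insert_commute)
  then show False using ac by blast
qed

section \<open>Removing an outer edge\<close>

text \<open>The edge is found at a frontier point of the unbounded face. Such a point is in no
  inside: an inside is open and misses the unbounded face, hence also misses its closure.\<close>

lemma outer_edge:
  assumes F: "F \<subseteq> E" and C0: "graph_cycle F C0"
  obtains C e z where "graph_cycle F C" "e \<in> edges_of (cycle_arcs C)"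
    "z \<in> path_image (\<gamma> e)" "z \<notin> p ` V" "\<And>D. graph_cycle F D \<Longrightarrow> z \<notin> region D"
proof -
  \<comment> \<open>Only edges on cycles are drawn, so that an outer edge cannot be a bridge or part
    of a tree hanging outside.\<close>
  define S where "S = \<Union>{edges_of (cycle_arcs C) |C. graph_cycle F C}"
  define K where "K = (\<Union>e\<in>S. path_image (\<gamma> e))"
  have SF: "S \<subseteq> F" by (auto simp: S_def graph_cycle_iff)
  have SE: "S \<subseteq> E" using SF F by blast
  have fS: "finite S" using SE finite_E finite_subset by blast
  have "compact K"
    unfolding K_def using fS SE arc_edge by (intro compact_UN) (auto intro: compact_arc_image)
  then have clK: "closed K" and bK: "bounded K" using compact_imp_closed compact_imp_bounded by auto
  obtain e0 where e0: "e0 \<in> S"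
  proof -
    obtain a ws b where "C0 = a # ws @ [b]" using C0 by (rule graph_cycleE)
    then have "{b, a} \<in> edges_of (cycle_arcs C0)" by (simp add: cycle_arcs_snoc)
    then show ?thesis using that C0 by (auto simp: S_def)
  qed
  obtain m where m: "m \<in> path_image (\<gamma> e0)" "m \<notin> p ` V"
    using edge_interior_point e0 SE by blast
  \<comment> \<open>The plane without the finitely many vertices is connected and meets both
    \<open>outside K\<close> and its complement, so it contains a frontier point of
    \<open>outside K\<close>.\<close>
  have "connected (UNIV - p ` V)"
    using finite_V by (intro connected_open_diff_countable) (auto intro: countable_finite)
  moreover have "(UNIV - p ` V) \<inter> outside K \<noteq> {}"
  proof
    assume "(UNIV - p ` V) \<inter> outside K = {}"
    then have "outside K \<subseteq> p ` V" by blast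
    then show False
      using unbounded_outside[OF bK] finite_V finite_imp_bounded bounded_subset by blast
  qed
  moreover have "(UNIV - p ` V) - outside K \<noteq> {}"
  proof -
    have "m \<in> K" using m e0 by (auto simp: K_def)
    then have "m \<notin> outside K" using outside_no_overlap[of K] by blast
    then show ?thesis using m by blast
  qed
  ultimately obtain z where z: "z \<notin> p ` V" "z \<in> frontier (outside K)"
    using connected_Int_frontier[of "UNIV - p ` V" "outside K"] by blast
  have "z \<in> K" using z(2) frontier_outside_subset[OF clK] by blast
  then obtain e C where eC: "graph_cycle F C" "e \<in> edges_of (cycle_arcs C)" "z \<in> path_image (\<gamma> e)"
    by (auto simp: K_def S_def)
  have "z \<notin> region D" if D: "graph_cycle F D" for D
  proof -
    have "draw (cycle_arcs D) \<subseteq> K" using D by (auto simp: K_def S_def draw_def)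
    then have "region D \<inter> outside K = {}"
      using outside_mono inside_Int_outside by blast
    moreover have "open (region D)"
      using cycle_inside(1) graph_cycle_mono[OF D F] by blast
    ultimately have "region D \<inter> closure (outside K) = {}"
      by (simp add: open_Int_closure_eq_empty)
    then show ?thesis using z(2) by (auto simp: frontier_def)
  qed
  then show ?thesis using that eC z(1) by blast
qed

text \<open>Only a cycle B through e could destroy the minimality of D. Its drawing contains z, so
  if its inside were within that of D, z would be inside D or on D; but z is in no inside and D
  avoids e.\<close>

lemma minimal_cycle_add_outer_edge:
  assumes F: "F \<subseteq> E" and e: "e \<in> F" "z \<in> path_image (\<gamma> e)" "z \<notin> p ` V"
    and outer: "\<And>D. graph_cycle F D \<Longrightarrow> z \<notin> region D"
    and D: "minimal_cycle (F - {e}) D"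
  shows "minimal_cycle F D"
proof -
  have gD: "graph_cycle (F - {e}) D" using D by (simp add: minimal_cycle_def)
  then have gD': "graph_cycle F D" using graph_cycle_mono by blast
  obtain f where f: "f \<in> edges_of (cycle_arcs D)"
    "\<And>B. graph_cycle (F - {e}) B \<Longrightarrow> f \<in> edges_of (cycle_arcs B) \<Longrightarrow> \<not> region B \<subset> region D"
    using D unfolding minimal_cycle_def by blast
  have "\<not> region B \<subset> region D" if B: "graph_cycle F B" "f \<in> edges_of (cycle_arcs B)" for B
  proof
    assume sub: "region B \<subset> region D"
    have gE: "graph_cycle E B" "graph_cycle E D" using B(1) gD' graph_cycle_mono[OF _ F] by auto
    have zdraw: "z \<in> draw (cycle_arcs A) \<longleftrightarrow> e \<in> edges_of (cycle_arcs A)" if "graph_cycle E A" for A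
      using that e F by (intro interior_point_in_draw_iff) (auto simp: graph_cycle_iff)
    have "e \<notin> edges_of (cycle_arcs B)"
    proof
      assume "e \<in> edges_of (cycle_arcs B)"
      then have "z \<in> draw (cycle_arcs B)" using zdraw gE by simp
      then have "z \<in> frontier (region B)" using cycle_inside(3)[OF gE(1)] by simp
      then have "z \<in> closure (region D)"
        using sub closure_mono[of "region B" "region D"] by (auto simp: frontier_def)
      then have "z \<in> region D \<or> z \<in> draw (cycle_arcs D)"
        using cycle_inside(3)[OF gE(2)] closure_Un_frontier[of "region D"] by blast
      then have "e \<in> edges_of (cycle_arcs D)" using outer[OF gD'] zdraw gE by blast
      then show False using gD by (auto simp: graph_cycle_iff)
    qed
    then have "graph_cycle (F - {e}) B" using B(1) by (auto simp: graph_cycle_iff)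
    then show False using f(2) B(2) sub by blast
  qed
  then show ?thesis using gD' f(1) unfolding minimal_cycle_def by blast
qed

text \<open>There are finitely many arc sets on V, hence finitely many insides, and a minimal one
  exists. Reversal keeps the inside, so the orientation can be chosen.\<close>

lemma minimal_cycle_through_edge:
  assumes F: "F \<subseteq> E" and C: "graph_cycle F C" "e \<in> edges_of (cycle_arcs C)"
  obtains D where "minimal_cycle F D" "positive_cycle D" "e \<in> edges_of (cycle_arcs D)"
proof -
  define R where "R = {region D |D. graph_cycle F D \<and> e \<in> edges_of (cycle_arcs D)}"
  have "R \<subseteq> (\<lambda>A. inside (draw A)) ` Pow (V \<times> V)"
  proof
    fix r assume "r \<in> R"
    then obtain D where D: "r = region D" "graph_cycle F D" by (auto simp: R_def)
    have "cycle_arcs D \<subseteq> V \<times> V"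
      using Field_subset_V[of "cycle_arcs D"] D(2) F
      by (auto simp: graph_cycle_iff dest: FieldI1 FieldI2)
    then show "r \<in> (\<lambda>A. inside (draw A)) ` Pow (V \<times> V)" using D(1) by blast
  qed
  then have "finite R" by (rule finite_subset) (simp add: finite_V)
  moreover have "R \<noteq> {}" using C by (auto simp: R_def)
  ultimately obtain r where r: "r \<in> R" "\<forall>s\<in>R. s \<subseteq> r \<longrightarrow> r = s"
    using finite_has_minimal by metis
  then obtain D where D: "graph_cycle F D" "e \<in> edges_of (cycle_arcs D)" "r = region D"
    by (auto simp: R_def)
  have min: "\<not> region B \<subset> region D" if "graph_cycle F B" "e \<in> edges_of (cycle_arcs B)" for B
    using r(2) D(3) that by (force simp: R_def)
  then have "minimal_cycle F D" "minimal_cycle F (rev D)"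
    unfolding minimal_cycle_def using D by (auto simp: graph_cycle_rev cycle_arcs_rev)
  moreover have "e \<in> edges_of (cycle_arcs (rev D))" using D by (simp add: cycle_arcs_rev)
  ultimately show ?thesis
    using that D positive_cycle_cases graph_cycle_mono[OF D(1) F] by blast
qed

text \<open>Induction over F, with all vectors indexed by the full set E so that they stay the same
  as F grows. Independence is over the reals because the Gram matrix argument needs real
  coefficients; the integral case follows.\<close>

lemma minimal_cycle_system:
  assumes "F \<subseteq> E" and ori: "orientation E ori"
  shows "\<exists>Cs. (\<forall>C\<in>set Cs. minimal_cycle F C \<and> positive_cycle C) \<and>
    sorted_wrt (\<lambda>C D. cycle_arcs C \<inter> cycle_arcs D = {}) Cs \<and>
    (\<forall>x\<in>flow_lattice V F ori. \<exists>c. x = int_comb c (map (cycle_vector E ori) Cs)) \<and>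
    (\<forall>c :: nat \<Rightarrow> real. (\<forall>e\<in>E. (\<Sum>i<length Cs. c i * cycle_vector E ori (Cs ! i) e) = 0) \<longrightarrow>
      (\<forall>i<length Cs. c i = 0))"
proof -
  have "finite F" using assms(1) finite_E finite_subset by blast
  then show ?thesis using assms(1)
  proof (induction F rule: finite_psubset_induct)
    case (psubset F)
    show ?case
    proof (cases "\<exists>C. graph_cycle F C")
      case False
      then have "\<forall>x\<in>flow_lattice V F ori. x = (\<lambda>e. 0)"
        using acyclic_flow_eq_0[OF psubset.prems _ ori] by blast
      then show ?thesis by (intro exI[of _ "[]"]) (simp add: int_comb_def)
    next
      case True
      then obtain C0 e z where C0: "graph_cycle F C0" "e \<in> edges_of (cycle_arcs C0)"
        and z: "z \<in> path_image (\<gamma> e)" "z \<notin> p ` V" "\<And>D. graph_cycle F D \<Longrightarrow> z \<notin> region D"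
        using outer_edge[OF psubset.prems] by metis
      have e: "e \<in> F" using C0 by (auto simp: graph_cycle_iff)
      then have eE: "e \<in> E" using psubset.prems by blast
      obtain C where C: "minimal_cycle F C" "positive_cycle C" "e \<in> edges_of (cycle_arcs C)"
        using minimal_cycle_through_edge[OF psubset.prems C0] by blast
      have gC: "graph_cycle F C" using C(1) by (simp add: minimal_cycle_def)
      let ?f = "cycle_vector E ori"
      obtain Cs where Cs: "\<And>D. D \<in> set Cs \<Longrightarrow> minimal_cycle (F - {e}) D"
        "\<And>D. D \<in> set Cs \<Longrightarrow> positive_cycle D"
        "sorted_wrt (\<lambda>C D. cycle_arcs C \<inter> cycle_arcs D = {}) Cs"
        "\<And>x. x \<in> flow_lattice V (F - {e}) ori \<Longrightarrow> \<exists>c. x = int_comb c (map ?f Cs)"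
        "\<And>c :: nat \<Rightarrow> real. (\<forall>e\<in>E. (\<Sum>i<length Cs. c i * ?f (Cs ! i) e) = 0) \<Longrightarrow>
          (\<forall>i<length Cs. c i = 0)"
      proof -
        have "F - {e} \<subset> F" "F - {e} \<subseteq> E" using psubset.prems e by auto
        from psubset.IH[OF this] show ?thesis
          by (elim exE conjE) (rule that; blast)
      qed
      have eD: "e \<notin> edges_of (cycle_arcs D)" if "D \<in> set Cs" for D
        using Cs(1)[OF that] by (auto simp: minimal_cycle_def graph_cycle_iff)
      have minD: "minimal_cycle F D" if "D \<in> set Cs" for D
        using minimal_cycle_add_outer_edge[OF psubset.prems e z] Cs(1)[OF that] by blast
      \<comment> \<open>A common arc makes the insides meet, so the two drawings coincide by
        minimality. But \<open>z\<close> lies on C and not on D, which avoids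
        \<open>e\<close>.\<close>
      have disj: "cycle_arcs C \<inter> cycle_arcs D = {}" if D: "D \<in> set Cs" for D
      proof (rule ccontr)
        assume "cycle_arcs C \<inter> cycle_arcs D \<noteq> {}"
        then obtain u v where uv: "(u, v) \<in> cycle_arcs C" "(u, v) \<in> cycle_arcs D" by auto
        have gE: "graph_cycle E C" "graph_cycle E D"
          using gC minD[OF D] graph_cycle_mono[OF _ psubset.prems] by (auto simp: minimal_cycle_def)
        have "draw (cycle_arcs C) = draw (cycle_arcs D)"
          using minimal_cycles_eq[OF psubset.prems C(1) minD[OF D]] edges_ofI[OF uv(1)] edges_ofI[OF uv(2)]
            insides_meet_if_common_arc[OF gE(1) C(2) gE(2) Cs(2)[OF D] uv] by blast
        moreover have "z \<in> draw (cycle_arcs A) \<longleftrightarrow> e \<in> edges_of (cycle_arcs A)"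
          if "graph_cycle E A" for A
          using that eE z by (intro interior_point_in_draw_iff) (auto simp: graph_cycle_iff)
        ultimately show False using C(3) eD[OF D] gE by blast
      qed
      have fe: "?f C e \<in> {1, -1}" by (rule cycle_vector_edge[OF ori eE C(3)])
      have fe0: "?f D e = 0" if "D \<in> set Cs" for D
        by (rule cycle_vector_eq_0[OF ori eD[OF that]])
      have span: "\<exists>c. x = int_comb c (map ?f (C # Cs))" if x: "x \<in> flow_lattice V F ori" for x
      proof -
        have fC: "?f C \<in> flow_lattice V F ori" by (rule cycle_vector_flow[OF psubset.prems gC ori])
        obtain k where k: "x e = of_int k" using x e by (auto simp: flow_lattice_def elim!: Ints_cases)
        \<comment> \<open>The entry of the new cycle at \<open>e\<close> is a unit, so an integer
          multiple of its vector cancels \<open>x\<close> there. The remainder \<open>y\<close> is a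
          flow that avoids \<open>e\<close>.\<close>
        obtain t where t: "x e = of_int t * ?f C e"
        proof (cases "?f C e = 1")
          case True
          then show ?thesis using that[of k] k by simp
        next
          case False
          then show ?thesis using that[of "- k"] k fe by simp
        qed
        define y where "y f = x f - of_int t * ?f C f" for f
        have ye: "y e = 0" by (simp add: y_def t)
        have "(\<Sum>f\<in>F - {e}. incidence ori v f * y f) = 0" if "v \<in> V" for v
        proof -
          have "(\<Sum>f\<in>F - {e}. incidence ori v f * y f) = (\<Sum>f\<in>F. incidence ori v f * y f)"
            using ye psubset.hyps by (intro sum.mono_neutral_left) auto
          also have "\<dots> = (\<Sum>f\<in>F. incidence ori v f * x f) -
              of_int t * (\<Sum>f\<in>F. incidence ori v f * ?f C f)"
            by (simp add: y_def algebra_simps sum_subtractf sum_distrib_left)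
          also have "\<dots> = 0" using x fC that by (simp add: flow_lattice_def)
          finally show ?thesis .
        qed
        then have "y \<in> flow_lattice V (F - {e}) ori"
          using x fC ye by (auto simp: flow_lattice_def y_def)
        then obtain c where c: "y = int_comb c (map ?f Cs)" using Cs(4) by blast
        have "x = int_comb (case_nat t c) (map ?f (C # Cs))"
          using c by (auto simp: int_comb_Cons comp_def y_def fun_eq_iff algebra_simps)
        then show ?thesis by blast
      qed
      \<comment> \<open>Among the vectors only that of C is nonzero at \<open>e\<close>, so
        evaluation at \<open>e\<close> forces its coefficient to vanish.\<close>
      have indep: "\<forall>i<length (C # Cs). c i = 0"
        if c: "\<forall>f\<in>E. (\<Sum>i<length (C # Cs). c i * ?f ((C # Cs) ! i) f) = 0" for c :: "nat \<Rightarrow> real"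
      proof -
        have eq: "c 0 * ?f C f + (\<Sum>i<length Cs. c (Suc i) * ?f (Cs ! i) f) = 0" if "f \<in> E" for f
          using c that by (simp add: sum.lessThan_Suc_shift del: sum.lessThan_Suc)
        have "(\<Sum>i<length Cs. c (Suc i) * ?f (Cs ! i) e) = 0"
          using fe0 by (intro sum.neutral) simp
        then have c0: "c 0 = 0" using eq[OF eE] fe by auto
        then have "\<forall>i<length Cs. c (Suc i) = 0" using eq by (intro Cs(5)) simp
        then show ?thesis using c0 by (auto simp: less_Suc_eq_0_disj)
      qed
      show ?thesis
      proof (intro exI[of _ "C # Cs"] conjI ballI allI impI)
        fix c :: "nat \<Rightarrow> real" and i
        assume "\<forall>f\<in>E. (\<Sum>i<length (C # Cs). c i * ?f ((C # Cs) ! i) f) = 0" "i < length (C # Cs)"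
        then show "c i = 0" using indep by blast
      qed (use C minD Cs(2,3) disj span in auto)
    qed
  qed
qed

end

section \<open>Gram matrices\<close>

text \<open>For an eigenvector v of the Gram matrix, k times the squared norm of v is the squared
  norm of its image under \<open>iota\<close>, the matrix with columns \<open>fs\<close>. The latter
  is positive by independence, hence so is the real part of k.\<close>

lemma gram_M_matrix:
  fixes fs :: "('e \<Rightarrow> real) list"
  assumes offdiag: "\<And>i j. i < length fs \<Longrightarrow> j < length fs \<Longrightarrow> i \<noteq> j \<Longrightarrow>
      (\<Sum>e\<in>E. (fs ! i) e * (fs ! j) e) \<le> 0"
    and indep: "\<And>c :: nat \<Rightarrow> real. (\<forall>e\<in>E. (\<Sum>i<length fs. c i * (fs ! i) e) = 0) \<Longrightarrow>
      (\<forall>i<length fs. c i = 0)"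
    and fin: "finite E"
  shows "M_matrix (dual_laplacian E fs)"
proof -
  let ?n = "length fs" and ?L = "dual_laplacian E fs"
  have "Re k > 0" if ev: "eigenvalue (map_mat complex_of_real ?L) k" for k
  proof -
    obtain v where v: "v \<in> carrier_vec ?n" "v \<noteq> 0\<^sub>v ?n"
      "map_mat complex_of_real ?L *\<^sub>v v = k \<cdot>\<^sub>v v"
      using ev by (auto simp: eigenvalue_def eigenvector_def dual_laplacian_def)
    \<comment> \<open>\<open>y\<close> is the image of \<open>v\<close> under the matrix with
      columns \<open>fs\<close>; \<open>M\<close> and \<open>N\<close> are the squared norms of
      \<open>y\<close> and \<open>v\<close>.\<close>
    define y where "y e = (\<Sum>j<?n. v $ j * of_real ((fs ! j) e))" for e
    define M where "M = (\<Sum>e\<in>E. (cmod (y e))\<^sup>2)"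
    define N where "N = (\<Sum>i<?n. (cmod (v $ i))\<^sup>2)"
    have row: "k * v $ i = (\<Sum>e\<in>E. of_real ((fs ! i) e) * y e)" if i: "i < ?n" for i
    proof -
      have "k * v $ i = (map_mat complex_of_real ?L *\<^sub>v v) $ i" using v i by simp
      also have "\<dots> = (\<Sum>j<?n. of_real (\<Sum>e\<in>E. (fs ! i) e * (fs ! j) e) * v $ j)"
        using v(1) i by (simp add: dual_laplacian_def scalar_prod_def atLeast0LessThan)
      also have "\<dots> = (\<Sum>j<?n. \<Sum>e\<in>E. of_real ((fs ! i) e) * (v $ j * of_real ((fs ! j) e)))"
        by (simp add: sum_distrib_left mult_ac)
      also have "\<dots> = (\<Sum>e\<in>E. of_real ((fs ! i) e) * y e)"
        unfolding y_def sum_distrib_left by (rule sum.swap)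
      finally show ?thesis .
    qed
    have "k * of_real N = (\<Sum>i<?n. cnj (v $ i) * (k * v $ i))"
      by (simp add: N_def sum_distrib_left complex_norm_square mult_ac del: of_real_power)
    also have "\<dots> = (\<Sum>i<?n. \<Sum>e\<in>E. cnj (v $ i) * of_real ((fs ! i) e) * y e)"
      by (intro sum.cong refl) (simp add: row sum_distrib_left mult_ac)
    also have "\<dots> = (\<Sum>e\<in>E. \<Sum>i<?n. cnj (v $ i) * of_real ((fs ! i) e) * y e)"
      by (rule sum.swap)
    also have "\<dots> = (\<Sum>e\<in>E. cnj (y e) * y e)"
      by (simp add: y_def sum_distrib_right)
    also have "\<dots> = of_real M"
      by (simp add: M_def complex_norm_square mult_ac del: of_real_power)
    finally have kN: "k * of_real N = of_real M" .
    have "M \<noteq> 0"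
    proof
      assume "M = 0"
      then have y0: "y e = 0" if "e \<in> E" for e
        using that fin by (simp add: M_def sum_nonneg_eq_0_iff)
      \<comment> \<open>The entries of \<open>fs\<close> are real, so the vanishing combination
        splits into its real and imaginary parts, and real independence applies to each.\<close>
      have "\<forall>i<?n. Re (v $ i) = 0"
      proof (rule indep, rule ballI)
        fix e assume "e \<in> E"
        then show "(\<Sum>i<?n. Re (v $ i) * (fs ! i) e) = 0"
          using arg_cong[OF y0, of e Re] by (simp add: y_def)
      qed
      moreover have "\<forall>i<?n. Im (v $ i) = 0"
      proof (rule indep, rule ballI)
        fix e assume "e \<in> E"
        then show "(\<Sum>i<?n. Im (v $ i) * (fs ! i) e) = 0"
          using arg_cong[OF y0, of e Im] by (simp add: y_def)
      qed
      ultimately have "v = 0\<^sub>v ?n" using v(1) by (intro eq_vecI) (auto simp: complex_eq_iff)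
      then show False using v(2) by simp
    qed
    moreover have "M \<ge> 0" "N \<ge> 0" by (simp_all add: M_def N_def sum_nonneg)
    moreover have "Re k * N = M" using arg_cong[OF kN, of Re] by simp
    ultimately show ?thesis by (metis mult_nonpos_nonneg antisym not_le)
  qed
  then show ?thesis
    using offdiag by (auto simp: M_matrix_def Z_matrix_def dual_laplacian_def)
qed

section \<open>Assembly of the cycle M-basis\<close>

theorem proposition4p2:
  fixes V :: "'v set" and E :: "'v set set" and ori :: "'v set \<Rightarrow> 'v \<times> 'v"
  assumes "simple_graph V E"
    and "graph_connected V E"
    and "planar_graph V E"
    and "orientation E ori"
  shows "\<exists>fs. cycle_M_basis V E ori fs"
proof -
  obtain p \<gamma> where "plane_drawing V E p \<gamma>" using assms(3) by (auto simp: planar_graph_def)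
  then interpret plane_graph V E p \<gamma> using assms(1) by unfold_locales
  obtain Cs where Cs: "\<And>C. C \<in> set Cs \<Longrightarrow> minimal_cycle E C"
    and disj: "sorted_wrt (\<lambda>C D. cycle_arcs C \<inter> cycle_arcs D = {}) Cs"
    and span: "\<And>x. x \<in> flow_lattice V E ori \<Longrightarrow> \<exists>c. x = int_comb c (map (cycle_vector E ori) Cs)"
    and indep: "\<And>c :: nat \<Rightarrow> real.
      (\<forall>e\<in>E. (\<Sum>i<length Cs. c i * cycle_vector E ori (Cs ! i) e) = 0) \<Longrightarrow> (\<forall>i<length Cs. c i = 0)"
    using minimal_cycle_system[OF subset_refl assms(4)] by blast
  define fs where "fs = map (cycle_vector E ori) Cs"
  have cyc: "graph_cycle E C" if "C \<in> set Cs" for C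
    using Cs[OF that] by (simp add: minimal_cycle_def)
  have "cycle_arcs (Cs ! i) \<inter> cycle_arcs (Cs ! j) = {}"
    if "i < length Cs" "j < length Cs" "i \<noteq> j" for i j
  proof (cases "i < j")
    case True
    then show ?thesis using disj that sorted_wrt_nth_less by blast
  next
    case False
    then have "j < i" using that by simp
    then show ?thesis using disj that sorted_wrt_nth_less by blast
  qed
  \<comment> \<open>Each off-diagonal entry is a sum over edges of nonpositive products, since
    distinct list positions carry arc-disjoint cycles.\<close>
  then have "M_matrix (dual_laplacian E fs)"
    using indep finite_E
    by (intro gram_M_matrix) (auto simp: fs_def intro!: sum_nonpos cycle_vector_mult_nonpos)
  moreover have "int_basis (flow_lattice V E ori) fs"
    unfolding int_basis_def
  proof (intro conjI ballI allI impI)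
    show "set fs \<subseteq> flow_lattice V E ori"
      using cycle_vector_flow[OF subset_refl cyc assms(4)] by (auto simp: fs_def)
    show "\<exists>c. x = int_comb c fs" if "x \<in> flow_lattice V E ori" for x
      using span[OF that] by (simp add: fs_def)
    fix c i assume c: "int_comb c fs = (\<lambda>e. 0)" and i: "i < length fs"
    have "\<forall>i<length Cs. real_of_int (c i) = 0"
      using fun_cong[OF c] by (intro indep) (simp add: int_comb_def fs_def)
    then show "c i = 0" using i by (simp add: fs_def)
  qed
  ultimately show ?thesis
    using cyc by (intro exI[of _ fs]) (auto simp: cycle_M_basis_def flow_M_basis_def fs_def)
qed

end
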